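(* Let $\boldsymbol{B}\in\mathbb{R}^{n\times n}$ be an index matrix with zero diagonal, let $\boldsymbol{g}=(g_1,\ldots,g_n)'\in R_{\boldsymbol{B}}$, and let $f$ be locally integrable on $[a,\infty)$ for some $a>0$. Define $C_0=f$ and $$C_i(t)=C_{i-1}(t)-\frac1t\int_a^t C_{i-1}(y)\,\mathrm{d}y,\qquad t\in[a,\infty),\ i\in\{1,\ldots,n\},$$ and put $\boldsymbol{C}=(C_1,\ldots,C_n)'$. If $f\in\Pi(\boldsymbol{g})$ with $\boldsymbol{g}$-index $\boldsymbol{c}=(c_1,\ldots,c_n)$, then there exists an upper triangular matrix $\boldsymbol{Q}\in\mathbb{R}^{n\times n}$ such that $$\boldsymbol{C}(t)=\boldsymbol{Q}\boldsymbol{g}(t)+o(g_n(t)),\qquad t\to\infty.$$ The matrix $\boldsymbol{Q}$ is non-singular if and only if $c_1\prod_{i=1}^{n-1}B_{i,i+1}\neq0$. In that case, $\boldsymbol{C}$ is a rate vector itself, $\boldsymbol{C}\in R_{\boldsymbol{K}_n}$, where $\boldsymbol{K}_n\in\mathbb{R}^{n\times n}$ is the matrix with $(\boldsymbol{K}_n)_{ij}=1$ for $i<j$ and $(\boldsymbol{K}_n)_{ij}=0$ for $i\geq j$, and $f\in\Pi(\boldsymbol{C})$ with $\boldsymbol{C}$-index $(1,\ldots,1)$.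
   Context: Limit relations are as $t\to\infty$; measurability and integrability are Lebesgue; locally integrable on $[a,\infty)$ means integrable on compact subintervals of $[a,\infty)$; an empty product equals $1$. A real function is defined in a neighbourhood of infinity if its domain contains some $[t_0,\infty)$; it is eventually of constant sign if it is either strictly positive for all large $t$ or strictly negative for all large $t$. A rate vector of length $n$ is a column vector $\boldsymbol{g}=(g_1,\ldots,g_n)'$ of real-valued functions defined in a neighbourhood of infinity, each eventually of constant sign, with $g_{i+1}(t)=o(g_i(t))$ for every $i\in\{1,\ldots,n-1\}$; $o(g_n(t))$ means $o(|g_n(t)|)$, componentwise for vectors. For a square matrix $\boldsymbol{B}$ and $x>0$, $x^{\boldsymbol{B}}=\exp\{(\log x)\boldsymbol{B}\}$. An index matrix is an upper triangular $\boldsymbol{B}\in\mathbb{R}^{n\times n}$ whose diagonal elements are non-increasing and all of whose eigenvalues, except possibly the smallest one, have geometric multiplicity one. A rate vector $\boldsymbol{g}$ belongs to $R_{\boldsymbol{B}}$ (is regularly varying with index matrix $\boldsymbol{B}$) if $\boldsymbol{g}$ is measurable and $\boldsymbol{g}(xt)=x^{\boldsymbol{B}}\boldsymbol{g}(t)+o(g_n(t))$ for every $x\in(0,\infty)$. For $\boldsymbol{g}\in R_{\boldsymbol{B}}$ with $\boldsymbol{B}$ having zero diagonal, $f\in\Pi(\boldsymbol{g})$ with $\boldsymbol{g}$-index $\boldsymbol{c}\in\mathbb{R}^{1\times n}$ means that $f$ is a measurable real-valued function defined in a neighbourhood of infinity and for every $x\in(0,\infty)$, $f(xt)=f(t)+\boldsymbol{h}(x)\boldsymbol{g}(t)+o(g_n(t))$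 with $\boldsymbol{h}(x)=\boldsymbol{c}\int_1^x y^{\boldsymbol{B}}y^{-1}\,\mathrm{d}y$. *)

theory Defs
  imports
    "HOL-Analysis.Analysis"
    "HOL-Library.Landau_Symbols"
    "Jordan_Normal_Form.Spectral_Radius"
    "Jordan_Normal_Form.Matrix_Kernel"
begin

no_notation vec_nth (infixl "$" 90)
no_notation inner (infix "\<bullet>" 70)

hide_type (open) Finite_Cartesian_Product.vec
hide_const (open) Finite_Cartesian_Product.vec Determinants.det

text \<open>
  Vectors and matrices are those of Jordan_Normal_Form, so indices start at 0: the entries
  \<open>g\<^sub>1\<close>, ..., \<open>g\<^sub>n\<close> of a vector are \<open>g t $ 0\<close>, ..., \<open>g t $ (n - 1)\<close>.
  A function defined on a subset of the reals is a total function together with its domain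
  \<open>D\<close>; the values outside \<open>D\<close> play no role.
\<close>

definition nbhd_infinity :: "real set \<Rightarrow> bool" where
  "nbhd_infinity D \<longleftrightarrow> (\<exists>t0. {t0..} \<subseteq> D)"

definition eventually_constant_sign :: "(real \<Rightarrow> real) \<Rightarrow> bool" where
  "eventually_constant_sign f \<longleftrightarrow>
     (\<forall>\<^sub>F t in at_top. f t > 0) \<or> (\<forall>\<^sub>F t in at_top. f t < 0)"

definition rate_vector :: "real set \<Rightarrow> nat \<Rightarrow> (real \<Rightarrow> real vec) \<Rightarrow> bool" where
  "rate_vector D n g \<longleftrightarrow>
     nbhd_infinity D \<and>
     (\<forall>t\<in>D. g t \<in> carrier_vec n) \<and>
     (\<forall>i<n. eventually_constant_sign (\<lambda>t. g t $ i)) \<and>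
     (\<forall>i. Suc i < n \<longrightarrow> (\<lambda>t. g t $ Suc i) \<in> o(\<lambda>t. g t $ i))"

text \<open>The componentwise relation \<open>u(t) = o(g\<^sub>n(t))\<close> for a vector-valued function \<open>u\<close>.\<close>

definition vec_smallo_last ::
    "nat \<Rightarrow> (real \<Rightarrow> real vec) \<Rightarrow> (real \<Rightarrow> real vec) \<Rightarrow> bool" where
  "vec_smallo_last n u g \<longleftrightarrow> (\<forall>i<n. (\<lambda>t. u t $ i) \<in> o(\<lambda>t. g t $ (n - 1)))"

text \<open>The exponential series of a square matrix, summed entrywise.\<close>

definition mat_exp :: "real mat \<Rightarrow> real mat" where
  "mat_exp A = mat (dim_row A) (dim_row A) (\<lambda>(i, j). \<Sum>k. (A ^\<^sub>m k) $$ (i, j) / fact k)"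

definition mat_powr :: "real \<Rightarrow> real mat \<Rightarrow> real mat" where
  "mat_powr x B = mat_exp (ln x \<cdot>\<^sub>m B)"

definition geometric_multiplicity :: "real mat \<Rightarrow> real \<Rightarrow> nat" where
  "geometric_multiplicity A e = kernel_dim (char_matrix A e)"

definition index_matrix :: "nat \<Rightarrow> real mat \<Rightarrow> bool" where
  "index_matrix n B \<longleftrightarrow>
     B \<in> carrier_mat n n \<and>
     upper_triangular B \<and>
     (\<forall>i j. i \<le> j \<longrightarrow> j < n \<longrightarrow> B $$ (j, j) \<le> B $$ (i, i)) \<and>
     (\<forall>e \<in> spectrum B - {Min (spectrum B)}. geometric_multiplicity B e = 1)"

definition zero_diagonal :: "nat \<Rightarrow> real mat \<Rightarrow> bool" where
  "zero_diagonal n B \<longleftrightarrow> (\<forall>i<n. B $$ (i, i) = 0)"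

definition regularly_varying ::
    "real set \<Rightarrow> nat \<Rightarrow> real mat \<Rightarrow> (real \<Rightarrow> real vec) \<Rightarrow> bool" where
  "regularly_varying D n B g \<longleftrightarrow>
     index_matrix n B \<and>
     rate_vector D n g \<and>
     (\<forall>i<n. (\<lambda>t. g t $ i) \<in> borel_measurable (lebesgue_on D)) \<and>
     (\<forall>x>0. vec_smallo_last n (\<lambda>t. g (x * t) - mat_powr x B *\<^sub>v g t) g)"

text \<open>
  The row vector \<open>c\<close> times the entrywise integral of \<open>y\<^sup>B / y\<close> from 1 to \<open>x\<close>
  (an oriented integral, as \<open>x\<close> may be less than 1).  Row vectors are represented as vectors,
  so multiplication by a matrix on the right is multiplication by its transpose.
\<close>

definition Pi_coeff :: "nat \<Rightarrow> real mat \<Rightarrow> real vec \<Rightarrow> real \<Rightarrow> real vec" where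
  "Pi_coeff n B c x =
     transpose_mat
       (mat n n (\<lambda>(i, j). LBINT y=ereal 1..ereal x. (mat_powr y B) $$ (i, j) / y)) *\<^sub>v c"

text \<open>
  The function \<open>f\<close> with domain \<open>D\<close> belongs to the class \<open>\<Pi>(g)\<close> with \<open>g\<close>-index \<open>c\<close>.  This is meant
  for a rate vector \<open>g\<close> that is regularly varying with index matrix \<open>B\<close>, where \<open>B\<close> has zero
  diagonal; \<open>B\<close> is an argument because the limit functions depend on it.
\<close>

definition Pi_varying ::
    "real set \<Rightarrow> nat \<Rightarrow> real mat \<Rightarrow> (real \<Rightarrow> real vec) \<Rightarrow> real vec \<Rightarrow> (real \<Rightarrow> real) \<Rightarrow> bool" where
  "Pi_varying D n B g c f \<longleftrightarrow>
     c \<in> carrier_vec n \<and>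
     nbhd_infinity D \<and>
     f \<in> borel_measurable (lebesgue_on D) \<and>
     (\<forall>x>0. (\<lambda>t. f (x * t) - f t - Pi_coeff n B c x \<bullet> g t) \<in> o(\<lambda>t. g t $ (n - 1)))"

definition locally_integrable_from :: "real \<Rightarrow> (real \<Rightarrow> real) \<Rightarrow> bool" where
  "locally_integrable_from a f \<longleftrightarrow> (\<forall>u v. a \<le> u \<longrightarrow> f absolutely_integrable_on {u..v})"

primrec mean_diff :: "real \<Rightarrow> (real \<Rightarrow> real) \<Rightarrow> nat \<Rightarrow> real \<Rightarrow> real" where
  "mean_diff a f 0 = f"
| "mean_diff a f (Suc i) =
     (\<lambda>t. mean_diff a f i t - 1 / t * (LINT y:{a..t}|lebesgue. mean_diff a f i y))"

definition mean_diff_vec :: "nat \<Rightarrow> real \<Rightarrow> (real \<Rightarrow> real) \<Rightarrow> real \<Rightarrow> real vec" where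
  "mean_diff_vec n a f t = vec n (\<lambda>i. mean_diff a f (Suc i) t)"

definition K_mat :: "nat \<Rightarrow> real mat" where
  "K_mat n = mat n n (\<lambda>(i, j). if i < j then 1 else 0)"

end

theory Submission
  imports Defs
begin

text \<open>
  Put \<open>w\<^sub>0 = f\<close> and \<open>w\<^sub>k\<^sub>+\<^sub>1 = c B\<^sup>k g\<close>.  As \<open>B\<close> is nilpotent, membership in \<open>\<Pi>(g)\<close> and \<open>R\<^sub>B\<close> says that the
  finitely many scalar functions \<open>w\<^sub>k\<close> obey the Taylor-like law
  \<open>w\<^sub>k(xt) = \<Sum>\<^sub>j (ln x)\<^sup>j / j! w\<^sub>k\<^sub>+\<^sub>j(t) + o(L(t))\<close>, where \<open>L = \<bar>g\<^sub>n\<bar>\<close> is slowly varying.  The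
  remainders satisfy a cocycle inequality, so a measure-theoretic averaging argument makes the law
  uniform for \<open>x\<close> in \<open>[1, 2]\<close>.

  If \<open>M\<close> is the mean of \<open>f\<close> and \<open>T = \<Sum>\<^sub>j (-1)\<^sup>j w\<^sub>j\<close>, integrating the law over \<open>[t, 2t]\<close> gives
  \<open>(M - T)(2t) = (M - T)(t) / 2 + o(L(t))\<close>, and since \<open>L(2t) \<sim> L(t)\<close> this recursion forces
  \<open>M - T = o(L)\<close>; no bound on the behaviour of \<open>f\<close> near \<open>a\<close> is needed.  Hence
  \<open>C\<^sub>1 = q\<^sub>1 g + o(g\<^sub>n)\<close> with \<open>q\<^sub>1 = c (I + B)\<^sup>-\<^sup>1\<close>, and inductively \<open>C\<^sub>i\<^sub>+\<^sub>1 = q\<^sub>i\<^sub>+\<^sub>1 g + o(g\<^sub>n)\<close> with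
  \<open>q\<^sub>i\<^sub>+\<^sub>1 (I + B) = q\<^sub>i B\<close>.  The matrix \<open>Q\<close> with rows \<open>q\<^sub>i\<close> then satisfies \<open>Q B = K Q\<close> and
  \<open>(1, ..., 1) Q = c\<close>, which transports the expansions of \<open>g\<close> and \<open>f\<close> to \<open>C\<close>.
\<close>

section \<open>Uniformity from pointwise convergence\<close>

text \<open>
  The averages of \<open>min 1 (R t y)\<close> over \<open>y\<close> tend to 0 by dominated convergence; as the dilated average
  starting from \<open>s t\<close> tends to 0 as well, for each \<open>s\<close> some common \<open>y\<close> makes both terms of the
  cocycle inequality small.
\<close>

lemma uniform_limit_from_pointwise:
  fixes R :: "real \<Rightarrow> real \<Rightarrow> real"
  assumes "t0 > 0" "K > 0"
    and nonneg: "\<And>t y. t \<ge> t0 \<Longrightarrow> y \<in> {1..4} \<Longrightarrow> R t y \<ge> 0"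
    and meas: "\<And>t. t \<ge> t0 \<Longrightarrow> R t \<in> borel_measurable (lebesgue_on {1..4})"
    and lim: "\<And>y. y \<in> {1..4} \<Longrightarrow> ((\<lambda>t. R t y) \<longlongrightarrow> 0) at_top"
    and sub: "\<And>t s y. t \<ge> t0 \<Longrightarrow> s \<in> {1..2} \<Longrightarrow> y \<in> {1..4} \<Longrightarrow> s * y \<in> {1..4} \<Longrightarrow>
                R t s \<le> K * (R t (s * y) + R (s * t) y)"
    and "e > 0"
  shows "\<forall>\<^sub>F t in at_top. \<forall>s\<in>{1..2}. R t s \<le> e"
proof -
  \<comment> \<open>Truncation at 1 supplies the dominating function; \<open>max t0 t\<close> makes
    \<open>psi t\<close> measurable and nonnegative for every \<open>t\<close>.\<close>
  define psi where "psi t y = min 1 (R (max t0 t) y)" for t y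
  have psi_int: "psi t absolutely_integrable_on {1..4}" for t
  proof (rule measurable_bounded_by_integrable_imp_absolutely_integrable)
    have "R (max t0 t) \<in> borel_measurable (lebesgue_on {1..4})" by (rule meas) simp
    then show "psi t \<in> borel_measurable (lebesgue_on {1..4})"
      unfolding psi_def by measurable
    show "(\<lambda>_. 1::real) integrable_on {1..4::real}" by (rule integrable_const_ivl)
    show "norm (psi t x) \<le> 1" if "x \<in> {1..4}" for x
      using nonneg[of "max t0 t" x] that by (simp add: psi_def)
  qed simp
  have psi_hk: "psi t integrable_on {u..v}" if "{u..v} \<subseteq> {1..4}" for t u v
    by (rule integrable_on_subinterval[OF set_lebesgue_integral_eq_integral(1)[OF psi_int] that])
  have psi_nonneg: "psi t y \<ge> 0" if "y \<in> {1..4}" for t y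
    using nonneg[of "max t0 t" y] that by (simp add: psi_def)
  have int_lim: "((\<lambda>t. integral {1..4} (psi t)) \<longlongrightarrow> 0) at_top"
  proof (rule tendsto_at_topI_sequentially)
    fix X :: "nat \<Rightarrow> real" assume X: "filterlim X at_top sequentially"
    have "(\<lambda>k. integral {1..4} (psi (X k))) \<longlonglongrightarrow> integral {1..4} (\<lambda>_::real. 0::real)"
    proof (rule dominated_convergence(2)[where h = "\<lambda>_. 1"])
      show "psi (X k) integrable_on {1..4}" for k
        by (rule psi_hk) simp
      show "norm (psi (X k) x) \<le> 1" if "x \<in> {1..4}" for x k
        using psi_nonneg[OF that] by (simp add: psi_def)
      show "(\<lambda>k. psi (X k) x) \<longlonglongrightarrow> 0" if x: "x \<in> {1..4}" for x
      proof -
        have "((\<lambda>t. min 1 (R t x)) \<longlongrightarrow> min 1 0) at_top"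
          by (intro tendsto_intros lim x)
        moreover have "\<forall>\<^sub>F t in at_top. min 1 (R t x) = psi t x"
          using eventually_ge_at_top[of t0] by eventually_elim (simp add: psi_def max_def)
        ultimately have "((\<lambda>t. psi t x) \<longlongrightarrow> 0) at_top"
          by (simp add: tendsto_cong)
        then show ?thesis using X by (rule filterlim_compose)
      qed
    qed (rule integrable_const_ivl)
    then show "(\<lambda>k. integral {1..4} (psi (X k))) \<longlonglongrightarrow> 0" by simp
  qed
  \<comment> \<open>The bound \<open>1/4\<close> keeps \<open>2 * h\<close> below the truncation
    level 1, so that smallness of \<open>psi\<close> passes to \<open>R\<close>; the other bound
    gives \<open>K * (4 * h) \<le> e\<close>.\<close>
  define h where "h = min (1/4) (e / (4 * K))"
  have h: "h > 0" "2 * h < 1" "K * (4 * h) \<le> e"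
    using \<open>e > 0\<close> \<open>K > 0\<close> by (auto simp: h_def min_def field_simps)
  have "\<forall>\<^sub>F t in at_top. integral {1..4} (psi t) < h"
    using order_tendstoD(2)[OF int_lim] h by blast
  then obtain T where T: "\<And>t. t \<ge> T \<Longrightarrow> integral {1..4} (psi t) < h"
    by (auto simp: eventually_at_top_linorder)
  show ?thesis
    unfolding eventually_at_top_linorder
  proof (intro exI allI impI ballI)
    fix t s :: real assume t: "max t0 T \<le> t" and s: "s \<in> {1..2}"
    have "t > 0" using t \<open>t0 > 0\<close> by simp
    have st: "s * t \<ge> t" using s \<open>t > 0\<close> by simp
    \<comment> \<open>If the sum were at least \<open>2 * h\<close> throughout
      \<open>{2..4}\<close>, its integral would be at least \<open>4 * h\<close>. But the first term
      contributes less than \<open>h\<close>, and the second, after substituting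
      \<open>y = s * z\<close> with \<open>s \<le> 2\<close>, less than
      \<open>2 * h\<close>.\<close>
    have "\<exists>y\<in>{2..4}. psi t y + psi (s * t) (y / s) < 2 * h"
    proof (rule ccontr)
      assume neg: "\<not> ?thesis"
      have i1: "psi t integrable_on {2..4}" by (rule psi_hk) simp
      have sub': "{2/s..4/s} \<subseteq> {1..4}" using s by (auto simp: field_simps)
      have i2: "psi (s * t) integrable_on {2/s..4/s}"
        by (rule psi_hk[OF sub'])
      have "((\<lambda>y. psi (s * t) ((1/s) * y)) has_integral (1 / \<bar>1/s\<bar>) *\<^sub>R integral {2/s..4/s} (psi (s*t)))
              ((\<lambda>x. x / (1/s)) ` {2/s..4/s})"
        by (rule has_integral_stretch_real) (use i2 s in \<open>auto simp: has_integral_integral\<close>)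
      moreover have "(\<lambda>x. x / (1/s)) ` {2/s..4/s} = {2..4}"
      proof -
        have "x \<in> (\<lambda>x. x * s) ` {2/s..4/s}" if "x \<in> {2..4}" for x
          using that s by (intro image_eqI[where x = "x / s"]) (auto simp: field_simps)
        then show ?thesis using s by (auto simp: field_simps)
      qed
      ultimately have hi2: "((\<lambda>y. psi (s * t) (y / s)) has_integral s * integral {2/s..4/s} (psi (s*t))) {2..4}"
        using s by simp
      have "((\<lambda>y. 2 * h) has_integral (4 - 2) *\<^sub>R (2 * h)) {2..4::real}"
        using has_integral_const_real[of "2*h" 2 4] by simp
      moreover have "((\<lambda>y. psi t y + psi (s * t) (y / s)) has_integral
         integral {2..4} (psi t) + s * integral {2/s..4/s} (psi (s*t))) {2..4}"
        using i1 hi2 by (intro has_integral_add) (auto simp: has_integral_integral)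
      ultimately have "(4 - 2) *\<^sub>R (2 * h) \<le> integral {2..4} (psi t) + s * integral {2/s..4/s} (psi (s*t))"
        by (rule has_integral_le) (use neg in \<open>auto simp: not_less\<close>)
      moreover have "integral {2..4} (psi t) \<le> integral {1..4} (psi t)"
        by (rule integral_subset_le) (auto intro: psi_hk psi_nonneg)
      moreover have "integral {1..4} (psi t) < h" using T t by simp
      moreover have "integral {2/s..4/s} (psi (s*t)) \<le> integral {1..4} (psi (s*t))"
        by (rule integral_subset_le) (use i2 sub' in \<open>auto intro: psi_hk psi_nonneg\<close>)
      moreover have "integral {1..4} (psi (s*t)) < h" using T t st by simp
      ultimately have *: "integral {2/s..4/s} (psi (s*t)) < h"
        "4 * h < h + s * integral {2/s..4/s} (psi (s*t))" by auto
      have "s * integral {2/s..4/s} (psi (s*t)) \<le> s * h"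
        using * s by (intro mult_left_mono) auto
      moreover have "s * h \<le> 2 * h" using s h by (intro mult_right_mono) auto
      ultimately show False using h * by linarith
    qed
    then obtain y where y: "y \<in> {2..4}" "psi t y + psi (s * t) (y / s) < 2 * h" by blast
    define z where "z = y / s"
    have z: "z \<in> {1..4}" "s * z = y" "y \<in> {1..4}" using y s by (auto simp: z_def field_simps)
    have "psi t y \<ge> 0" "psi (s*t) z \<ge> 0" using psi_nonneg z by auto
    then have "psi t y < 2*h" "psi (s*t) z < 2*h" using y by (auto simp: z_def)
    then have "R t y \<le> 2 * h" "R (s*t) z \<le> 2 * h"
      using h t st by (auto simp: psi_def max_def min_def split: if_splits)
    then have "K * (R t (s * z) + R (s * t) z) \<le> K * (4 * h)"
      using \<open>K > 0\<close> z by (intro mult_left_mono) auto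
    then show "R t s \<le> e" using sub[of t s z] z s t h by simp
  qed
qed

section \<open>Truncated exponentials of the index shift on sequences vanishing beyond
  \<open>m\<close>\<close>

definition shift_exp :: "nat \<Rightarrow> real \<Rightarrow> (nat \<Rightarrow> real) \<Rightarrow> nat \<Rightarrow> real" where
  "shift_exp m b x k = (\<Sum>j\<le>m. b ^ j / fact j * x (k + j))"

lemma shift_exp_0 [simp]: "shift_exp m 0 x k = x k"
proof -
  have "shift_exp m 0 x k = (\<Sum>j\<le>m. if j = 0 then x k else 0)"
    unfolding shift_exp_def by (rule sum.cong) auto
  then show ?thesis by simp
qed

lemma shift_exp_diff:
  "shift_exp m b (\<lambda>l. x l - y l) k = shift_exp m b x k - shift_exp m b y k"
  by (simp add: shift_exp_def right_diff_distrib sum_subtractf)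

lemma shift_exp_eq_0:
  assumes "\<And>l. l > m \<Longrightarrow> x l = 0" "k > m"
  shows "shift_exp m b x k = 0"
  using assms by (simp add: shift_exp_def)

text \<open>Two truncated power series in the shift compose to their Cauchy product: every index
  pair with \<open>j + i > m\<close> meets a zero of \<open>x\<close>, so cutting off at
  \<open>m\<close> loses nothing.\<close>

lemma sum_shift_convolution:
  fixes u v x :: "nat \<Rightarrow> real"
  assumes zero: "\<And>l. l > m \<Longrightarrow> x l = 0"
  shows "(\<Sum>j\<le>m. u j * (\<Sum>i\<le>m. v i * x (k + j + i))) =
    (\<Sum>l\<le>m. (\<Sum>j\<le>l. u j * v (l - j)) * x (k + l))"
proof -
  let ?g = "\<lambda>j i. u j * v i * x (k + (j + i))"
  have "(\<Sum>j\<le>m. u j * (\<Sum>i\<le>m. v i * x (k + j + i))) = (\<Sum>(j, i)\<in>{..m} \<times> {..m}. ?g j i)"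
    by (simp add: sum_distrib_left mult_ac add_ac sum.cartesian_product)
  also have "\<dots> = (\<Sum>(j, i)\<in>{(j, i). j + i \<le> m}. ?g j i)"
  proof (rule sum.mono_neutral_right)
    show "\<forall>p\<in>{..m} \<times> {..m} - {(j, i). j + i \<le> m}. (case p of (j, i) \<Rightarrow> ?g j i) = 0"
    proof
      fix p assume p: "p \<in> {..m} \<times> {..m} - {(j, i). j + i \<le> m}"
      then have "x (k + (fst p + snd p)) = 0" by (intro zero) auto
      then show "(case p of (j, i) \<Rightarrow> ?g j i) = 0" by (simp add: case_prod_unfold)
    qed
  qed auto
  also have "\<dots> = (\<Sum>l\<le>m. \<Sum>j\<le>l. ?g j (l - j))"
    by (rule sum.triangle_reindex_eq)
  finally show ?thesis by (simp add: sum_distrib_right)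
qed

text \<open>The exponential law for the shift, from the binomial theorem. With
  \<open>a = - b\<close> it inverts \<open>shift_exp\<close>, as the cocycle identity for remainders
  requires.\<close>

lemma shift_exp_add:
  assumes zero: "\<And>l. l > m \<Longrightarrow> x l = 0"
  shows "shift_exp m a (shift_exp m b x) k = shift_exp m (a + b) x k"
proof -
  have "(\<Sum>j\<le>l. a ^ j / fact j * (b ^ (l - j) / fact (l - j))) = (a + b) ^ l / fact l" for l
  proof -
    have "(\<Sum>j\<le>l. a ^ j / fact j * (b ^ (l - j) / fact (l - j))) =
        (\<Sum>j\<le>l. of_nat (l choose j) * a ^ j * b ^ (l - j)) / fact l"
      unfolding sum_divide_distrib by (rule sum.cong) (auto simp: binomial_fact field_simps)
    then show ?thesis by (simp add: binomial_ring)
  qed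
  with sum_shift_convolution[where u = "\<lambda>j. a ^ j / fact j" and v = "\<lambda>j. b ^ j / fact j" and k = k, OF zero]
  show ?thesis by (simp add: shift_exp_def)
qed

lemma abs_shift_exp_le:
  assumes "\<And>l. l > m \<Longrightarrow> x l = 0" "\<bar>b\<bar> \<le> c"
  shows "\<bar>shift_exp m b x k\<bar> \<le> (\<Sum>j\<le>m. c ^ j / fact j) * (\<Sum>l\<le>m. \<bar>x l\<bar>)"
proof -
  have x: "\<bar>x l\<bar> \<le> (\<Sum>l\<le>m. \<bar>x l\<bar>)" for l
  proof (cases "l \<le> m")
    case True
    then show ?thesis by (intro member_le_sum) auto
  qed (use assms(1) in \<open>auto intro!: sum_nonneg\<close>)
  have "\<bar>shift_exp m b x k\<bar> \<le> (\<Sum>j\<le>m. \<bar>b ^ j / fact j * x (k + j)\<bar>)"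
    unfolding shift_exp_def by (rule sum_abs)
  also have "\<dots> \<le> (\<Sum>j\<le>m. c ^ j / fact j * (\<Sum>l\<le>m. \<bar>x l\<bar>))"
    unfolding abs_mult abs_divide power_abs
  proof (intro sum_mono mult_mono)
    show "\<bar>b\<bar> ^ j / \<bar>fact j\<bar> \<le> c ^ j / fact j" for j
      using assms(2) by (simp add: divide_right_mono power_mono)
    show "0 \<le> c ^ j / fact j" for j using assms(2) by simp
  qed (use x in auto)
  finally show ?thesis by (simp add: sum_distrib_right)
qed

text \<open>Composition with a merely Lebesgue measurable function is safe here because scaling is
  measurable from Lebesgue sets to Lebesgue sets.\<close>

lemma measurable_dilation:
  fixes u :: "real \<Rightarrow> real"
  assumes "u \<in> borel_measurable (lebesgue_on {t0..})" "t0 > 0" "t \<ge> t0" "p \<ge> 1"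
  shows "(\<lambda>y. u (y * t)) \<in> borel_measurable (lebesgue_on {p..q})"
proof -
  have "(\<lambda>y. t *\<^sub>R y) \<in> lebesgue_on {p..q} \<rightarrow>\<^sub>M lebesgue_on {t0..}"
  proof (rule measurable_restrict_space3[OF lebesgue_measurable_scaling])
    have "t0 * 1 \<le> t * y" if "y \<ge> p" for y
      using that assms by (intro mult_mono) auto
    then show "(*\<^sub>R) t \<in> {p..q} \<rightarrow> {t0..}" by auto
  qed
  from measurable_compose[OF this assms(1)] show ?thesis by (simp add: mult.commute)
qed

text \<open>Scalar form of the problem: in the application \<open>L\<close> is the modulus of the
  last component of \<open>g\<close>, \<open>w 0\<close> is the function whose mean is studied, and
  \<open>w (Suc k) t\<close> is \<open>p \<bullet> (B ^\<^sub>m k *\<^sub>v g t)\<close>. Stating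
  the law for \<open>x \<ge> 1\<close> keeps all arguments in \<open>{t0..}\<close>.\<close>

locale shift_system =
  fixes m :: nat and t0 :: real and L :: "real \<Rightarrow> real" and w :: "nat \<Rightarrow> real \<Rightarrow> real"
  assumes t0_pos: "t0 > 0"
    and L_pos: "\<And>t. t \<ge> t0 \<Longrightarrow> L t > 0"
    and L_meas: "L \<in> borel_measurable (lebesgue_on {t0..})"
    and L_slow: "\<And>x. x \<ge> 1 \<Longrightarrow> ((\<lambda>t. L (x * t) / L t) \<longlongrightarrow> 1) at_top"
    and w_meas: "\<And>k. w k \<in> borel_measurable (lebesgue_on {t0..})"
    and w_zero: "\<And>k t. t \<ge> t0 \<Longrightarrow> k > m \<Longrightarrow> w k t = 0"
    and w_lim: "\<And>k x. x \<ge> 1 \<Longrightarrow>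
      ((\<lambda>t. (w k (x * t) - shift_exp m (ln x) (\<lambda>l. w l t) k) / L t) \<longlongrightarrow> 0) at_top"
begin

lemma dilate_ge: "t \<ge> t0 \<Longrightarrow> x \<ge> 1 \<Longrightarrow> x * t \<ge> t0"
  using t0_pos mult_right_mono[of 1 x t] by linarith

text \<open>The uniform convergence theorem for the slowly varying \<open>L\<close>. The logarithmic
  increments are additive along \<open>t\<close>, \<open>s * t\<close>, \<open>s * y * t\<close>, so
  the cocycle inequality holds with constant 1.\<close>

lemma L_uniform:
  assumes "e > 0"
  shows "\<forall>\<^sub>F t in at_top. \<forall>s\<in>{1..2}. \<bar>ln (L (s * t)) - ln (L t)\<bar> \<le> e"
proof (rule uniform_limit_from_pointwise[where K = 1, OF t0_pos])
  fix t :: real assume t: "t \<ge> t0"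
  note [measurable] = measurable_dilation[OF L_meas t0_pos t order_refl]
  show "(\<lambda>s. \<bar>ln (L (s * t)) - ln (L t)\<bar>) \<in> borel_measurable (lebesgue_on {1..4})"
    by measurable
next
  fix y :: real assume y: "y \<in> {1..4}"
  have "((\<lambda>t. \<bar>ln (L (y * t) / L t)\<bar>) \<longlongrightarrow> \<bar>ln 1\<bar>) at_top"
    using y by (intro tendsto_intros L_slow) auto
  moreover have "\<forall>\<^sub>F t in at_top. \<bar>ln (L (y * t) / L t)\<bar> = \<bar>ln (L (y * t)) - ln (L t)\<bar>"
    using eventually_ge_at_top[of t0]
  proof eventually_elim
    case (elim t)
    have "L t > 0" "L (y * t) > 0" using elim y L_pos dilate_ge by auto
    then show ?case by (simp add: ln_div)
  qed
  ultimately show "((\<lambda>t. \<bar>ln (L (y * t)) - ln (L t)\<bar>) \<longlongrightarrow> 0) at_top"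
    by (simp add: tendsto_cong)
qed (use t0_pos assms in \<open>auto simp: mult_ac\<close>)

text \<open>The factor \<open>3/2\<close> is below 2, so halving combined with the change from
  \<open>L t\<close> to \<open>L (2 * t)\<close> still contracts, with factor
  \<open>3/4\<close>.\<close>

lemma L_doubling:
  "\<forall>\<^sub>F t in at_top. \<forall>s\<in>{1..2}. L (s * t) \<le> 3/2 * L t \<and> L t \<le> 3/2 * L (s * t)"
proof -
  have "ln (3/2::real) > 0" by simp
  from L_uniform[OF this] eventually_ge_at_top[of t0] show ?thesis
  proof eventually_elim
    case (elim t)
    show ?case
    proof
      fix s :: real assume s: "s \<in> {1..2}"
      have pos: "L t > 0" "L (s * t) > 0" using elim s L_pos dilate_ge by auto
      have pos': "3/2 * L t > 0" "3/2 * L (s * t) > 0" using pos by simp_all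
      have "ln (3/2 * L t) = ln (3/2) + ln (L t)" "ln (3/2 * L (s * t)) = ln (3/2) + ln (L (s * t))"
        by (rule ln_mult_pos, simp, rule pos)+
      then have ln_le: "ln (L (s * t)) \<le> ln (3/2 * L t)" "ln (L t) \<le> ln (3/2 * L (s * t))"
        using elim(1)[rule_format, OF s] by linarith+
      then show "L (s * t) \<le> 3/2 * L t \<and> L t \<le> 3/2 * L (s * t)"
        using ln_le_cancel_iff[THEN iffD1, OF pos(2) pos'(1)]
          ln_le_cancel_iff[THEN iffD1, OF pos(1) pos'(2)] by blast
    qed
  qed
qed

definition rem :: "real \<Rightarrow> real \<Rightarrow> nat \<Rightarrow> real" where
  "rem t y k = w k (y * t) - shift_exp m (ln y) (\<lambda>l. w l t) k"

lemma rem_zero: "t \<ge> t0 \<Longrightarrow> y \<ge> 1 \<Longrightarrow> k > m \<Longrightarrow> rem t y k = 0"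
  by (simp add: rem_def w_zero dilate_ge shift_exp_eq_0)

text \<open>Going from \<open>t\<close> to \<open>s * y * t\<close> directly or via
  \<open>s * t\<close> differs by the shift exponential for \<open>ln y\<close> applied to
  \<open>rem t s\<close>; the one for \<open>- ln y\<close> undoes it.\<close>

lemma rem_cocycle:
  assumes "t \<ge> t0" "s \<ge> 1" "y \<ge> 1"
  shows "rem t s k = shift_exp m (- ln y) (\<lambda>l. rem t (s * y) l - rem (s * t) y l) k"
proof -
  have "(\<lambda>l. rem t (s * y) l - rem (s * t) y l) =
     (\<lambda>l. shift_exp m (ln y) (\<lambda>l. w l (s * t)) l - shift_exp m (ln y + ln s) (\<lambda>l. w l t) l)"
    using assms by (auto simp: rem_def fun_eq_iff ln_mult mult_ac add_ac)
  then show ?thesis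
    using assms by (simp add: shift_exp_diff shift_exp_add w_zero dilate_ge rem_def)
qed

text \<open>The shift mixes the components, so pointwise convergence is made uniform for the sum of
  all remainders, divided by \<open>L t\<close>.\<close>

lemma rem_uniform:
  assumes "e > 0"
  shows "\<forall>\<^sub>F t in at_top. \<forall>s\<in>{1..2}. (\<Sum>k\<le>m. \<bar>rem t s k\<bar>) \<le> e * L t"
proof -
  obtain T where T: "\<And>t s. t \<ge> T \<Longrightarrow> s \<in> {1..2} \<Longrightarrow> L (s * t) \<le> 3/2 * L t"
    using L_doubling unfolding eventually_at_top_linorder by blast
  \<comment> \<open>The base 3 bounds the modulus of \<open>ln y\<close> on \<open>{1..4}\<close>,
    by \<open>ln y \<le> y - 1\<close>.\<close>
  define C where "C = (\<Sum>j\<le>m. 3 ^ j / fact j :: real)"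
  have "C > 0" unfolding C_def by (intro sum_pos) auto
  let ?S = "\<lambda>t s. \<Sum>k\<le>m. \<bar>rem t s k\<bar>"
  have "\<forall>\<^sub>F t in at_top. \<forall>s\<in>{1..2}. ?S t s / L t \<le> e"
  \<comment> \<open>Here \<open>m + 1\<close> counts the components, \<open>C\<close> bounds the
    inverse shift exponential, and \<open>3/2\<close> bounds \<open>L (s * t) / L t\<close>.\<close>
  proof (rule uniform_limit_from_pointwise[of "max t0 T" "3/2 * (m + 1) * C"])
    fix t y :: real assume t: "max t0 T \<le> t" and y: "y \<in> {1..4}"
    show "0 \<le> ?S t y / L t"
      using L_pos[of t] t by (intro divide_nonneg_nonneg sum_nonneg) auto
  next
    fix t :: real assume t: "max t0 T \<le> t"
    have [measurable]: "(\<lambda>y. w k (y * t)) \<in> borel_measurable (lebesgue_on {1..4})" for k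
      using t by (intro measurable_dilation[OF w_meas t0_pos]) auto
    have [measurable]: "(\<lambda>y::real. ln y) \<in> borel_measurable (lebesgue_on {1..4})"
      by (intro borel_measurable_ln measurable_restrict_space1) (simp add: measurable_completion)
    show "(\<lambda>y. ?S t y / L t) \<in> borel_measurable (lebesgue_on {1..4})"
      unfolding rem_def shift_exp_def by measurable
  next
    fix y :: real assume y: "y \<in> {1..4}"
    have "((\<lambda>t. \<Sum>k\<le>m. \<bar>rem t y k / L t\<bar>) \<longlongrightarrow> (\<Sum>k\<le>m. \<bar>0\<bar>)) at_top"
      unfolding rem_def using y by (intro tendsto_intros w_lim) auto
    moreover have "\<forall>\<^sub>F t in at_top. (\<Sum>k\<le>m. \<bar>rem t y k / L t\<bar>) = ?S t y / L t"
      using eventually_ge_at_top[of t0]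
      by eventually_elim (use L_pos in \<open>auto simp: sum_divide_distrib abs_of_pos\<close>)
    ultimately show "((\<lambda>t. ?S t y / L t) \<longlongrightarrow> 0) at_top"
      by (simp add: tendsto_cong)
  next
    fix t s y :: real
    assume t: "max t0 T \<le> t" and s: "s \<in> {1..2}" and y: "y \<in> {1..4}" and sy: "s * y \<in> {1..4}"
    have L: "L t > 0" "L (s * t) > 0" using t s L_pos dilate_ge by auto
    have "\<bar>- ln y\<bar> \<le> 3" using y ln_le_minus_one[of y] by simp
    have "?S t s \<le> (\<Sum>k\<le>m. C * (\<Sum>l\<le>m. \<bar>rem t (s * y) l - rem (s * t) y l\<bar>))"
    proof (rule sum_mono)
      fix k
      show "\<bar>rem t s k\<bar> \<le> C * (\<Sum>l\<le>m. \<bar>rem t (s * y) l - rem (s * t) y l\<bar>)"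
        unfolding C_def using t s y sy \<open>\<bar>- ln y\<bar> \<le> 3\<close>
        by (subst rem_cocycle[of t s y]) (auto intro!: abs_shift_exp_le simp: rem_zero dilate_ge)
    qed
    also have "\<dots> = (m + 1) * C * (\<Sum>l\<le>m. \<bar>rem t (s * y) l - rem (s * t) y l\<bar>)" by simp
    also have "\<dots> \<le> (m + 1) * C * (?S t (s * y) + ?S (s * t) y)"
      unfolding sum.distrib[symmetric] using \<open>C > 0\<close>
      by (intro mult_left_mono sum_mono abs_triangle_ineq4) auto
    finally have "?S t s / L t \<le> (m + 1) * C * (?S t (s * y) + ?S (s * t) y) / L t"
      using L by (simp add: divide_right_mono)
    also have "\<dots> = (m + 1) * C * (?S t (s * y) / L t + ?S (s * t) y / L (s * t) * (L (s * t) / L t))"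
      using L by (simp add: field_simps)
    also have "\<dots> \<le> (m + 1) * C * (3/2 * (?S t (s * y) / L t) + ?S (s * t) y / L (s * t) * (3/2))"
    proof (intro mult_left_mono add_mono)
      show "?S t (s * y) / L t \<le> 3/2 * (?S t (s * y) / L t)"
      proof -
        have "0 \<le> ?S t (s * y) / L t" using L by (simp add: sum_nonneg)
        then show ?thesis by linarith
      qed
      show "L (s * t) / L t \<le> 3/2" using T[of t s] t s L by (simp add: field_simps)
      show "0 \<le> ?S (s * t) y / L (s * t)" using L by (simp add: sum_nonneg)
    qed (use \<open>C > 0\<close> in auto)
    finally show "?S t s / L t \<le> 3/2 * (m + 1) * C * (?S t (s * y) / L t + ?S (s * t) y / L (s * t))"
      by (simp add: algebra_simps)
  qed (use t0_pos assms \<open>C > 0\<close> in auto)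
  then show ?thesis using eventually_ge_at_top[of t0]
    by eventually_elim (use L_pos in \<open>auto simp: pos_divide_le_eq\<close>)
qed

end

section \<open>Asymptotics of the mean\<close>

text \<open>Boundedness on one block from \<open>U\<close> to \<open>2 * U\<close> spreads to all
  larger arguments by the recursion; iterating it again gives geometric decay down to its fixed
  point.\<close>

lemma tendsto_0_if_halving:
  fixes E :: "real \<Rightarrow> real"
  assumes nonneg: "\<And>t. E t \<ge> 0"
    and halving: "\<And>e. e > 0 \<Longrightarrow> \<forall>\<^sub>F t in at_top. E (2 * t) \<le> 3/4 * E t + e"
    and bounded: "\<forall>\<^sub>F U in at_top. \<exists>C. \<forall>s\<in>{1..2}. E (s * U) \<le> C"
  shows "(E \<longlongrightarrow> 0) at_top"
proof (rule tendstoI)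
  fix e :: real assume "e > 0"
  have "\<forall>\<^sub>F U in at_top. \<forall>t\<ge>U. E (2 * t) \<le> 3/4 * E t + e / 8"
    using halving[of "e / 8"] \<open>e > 0\<close> by (intro eventually_all_ge_at_top) auto
  then have "\<forall>\<^sub>F U in at_top. U > 0 \<and> (\<forall>t\<ge>U. E (2 * t) \<le> 3/4 * E t + e / 8) \<and>
      (\<exists>C. \<forall>s\<in>{1..2}. E (s * U) \<le> C)"
    using eventually_gt_at_top[of 0] bounded by (intro eventually_conj)
  from eventually_happens'[OF trivial_limit_at_top_linorder this]
  obtain U where U: "U > 0" "\<And>t. t \<ge> U \<Longrightarrow> E (2 * t) \<le> 3/4 * E t + e / 8"
    and "\<exists>C. \<forall>s\<in>{1..2}. E (s * U) \<le> C" by blast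
  then obtain C where C: "\<And>s. s \<in> {1..2} \<Longrightarrow> E (s * U) \<le> C" by blast
  \<comment> \<open>With error \<open>e / 8\<close> the recursion has the fixed point
    \<open>e / 2\<close>, so a bound of at least \<open>e / 2\<close> survives each
    doubling.\<close>
  define K where "K = max C (e / 2)"
  have K: "E t \<le> K" if "U \<le> t" "t \<le> 2 ^ j * U" for t j
    using that
  proof (induction j arbitrary: t)
    case (Suc j)
    show ?case
    proof (cases "t \<le> 2 * U")
      case True
      then show ?thesis using C[of "t / U"] U(1) Suc.prems by (auto simp: K_def field_simps)
    next
      case False
      then have "E (t / 2) \<le> K" using Suc.prems by (intro Suc.IH) auto
      then show ?thesis using U(2)[of "t / 2"] False by (auto simp: K_def)
    qed
  qed (use C[of 1] in \<open>auto simp: K_def\<close>)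
  have K': "E t \<le> K" if "U \<le> t" for t
  proof -
    obtain j where "t / U < 2 ^ j" using real_arch_pow[of 2] by auto
    then show ?thesis using K[of t j] that U(1) by (simp add: pos_divide_less_eq)
  qed
  have decay: "E t \<le> (3/4) ^ k * K + e / 2" if "2 ^ k * U \<le> t" for t k
    using that
  proof (induction k arbitrary: t)
    case (Suc k)
    then have "E (t / 2) \<le> (3/4) ^ k * K + e / 2" by simp
    moreover have "1 * U \<le> 2 ^ k * U" using U(1) by (intro mult_right_mono) auto
    then have "t / 2 \<ge> U" using Suc.prems by simp
    ultimately show ?case using U(2)[of "t / 2"] by simp
  next
    case 0
    then have "E t \<le> K" by (intro K') simp
    then show ?case using \<open>e > 0\<close> by simp
  qed
  have "((\<lambda>k. (3/4) ^ k * K) \<longlonglongrightarrow> 0 * K)"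
    by (intro tendsto_intros LIMSEQ_power_zero) auto
  then have "\<forall>\<^sub>F k in sequentially. (3/4) ^ k * K < e / 2"
    using \<open>e > 0\<close> by (intro order_tendstoD(2)) auto
  then obtain k where "(3/4) ^ k * K < e / 2" by (auto simp: eventually_sequentially)
  then have "E t < e" if "2 ^ k * U \<le> t" for t
    using decay[OF that] by linarith
  then show "\<forall>\<^sub>F t in at_top. dist (E t) 0 < e"
    using nonneg unfolding eventually_at_top_linorder by (intro exI[of _ "2 ^ k * U"]) simp
qed

text \<open>\<open>y * log_alt l y\<close> is the antiderivative of \<open>(ln y)\<^sup>l / l!\<close>.\<close>

definition log_alt :: "nat \<Rightarrow> real \<Rightarrow> real" where
  "log_alt l y = (\<Sum>j\<le>l. (-1) ^ j * (ln y ^ (l - j) / fact (l - j)))"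

lemma log_alt_Suc: "log_alt (Suc l) y = ln y ^ Suc l / fact (Suc l) - log_alt l y"
  unfolding log_alt_def by (subst sum.atMost_Suc_shift) (simp add: sum_negf[symmetric])

lemma log_alt_1: "log_alt l 1 = (-1) ^ l"
  by (induction l) (simp_all add: log_alt_Suc, simp add: log_alt_def)

text \<open>The product rule yields the logarithmic power itself plus the next lower one;
  subtracting the antiderivative of the latter is the recursion \<open>log_alt_Suc\<close>.\<close>

lemma log_alt_deriv:
  assumes "y > 0"
  shows "((\<lambda>y. y * log_alt l y) has_real_derivative ln y ^ l / fact l) (at y)"
proof (induction l)
  case 0
  then show ?case by (auto simp: log_alt_def intro!: derivative_eq_intros)
next
  case (Suc l)
  have "((\<lambda>y. y * (ln y ^ Suc l / fact (Suc l))) has_real_derivative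
     1 * (ln y ^ Suc l / fact (Suc l)) + (1 + real l) * (1 / y * ln y ^ l) / fact (Suc l) * y) (at y)"
    by (intro DERIV_mult DERIV_ident DERIV_cdivide DERIV_power_Suc DERIV_ln_divide assms)
  moreover have "(1 + real l) * (1 / y * ln y ^ l) / fact (Suc l) * y = ln y ^ l / fact l"
    using assms by (simp add: divide_simps)
  ultimately have "((\<lambda>y. y * (ln y ^ Suc l / fact (Suc l))) has_real_derivative
     ln y ^ Suc l / fact (Suc l) + ln y ^ l / fact l) (at y)" by simp
  from DERIV_diff[OF this Suc.IH]
  have "((\<lambda>y. y * (ln y ^ Suc l / fact (Suc l)) - y * log_alt l y) has_real_derivative
     ln y ^ Suc l / fact (Suc l)) (at y)" by simp
  then show ?case by (simp only: log_alt_Suc right_diff_distrib)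
qed

lemma has_integral_ln_power:
  "((\<lambda>y. ln y ^ l / fact l) has_integral 2 * log_alt l 2 - (-1) ^ l) {1..2::real}"
proof -
  have "((\<lambda>y. ln y ^ l / fact l) has_integral 2 * log_alt l 2 - 1 * log_alt l 1) {1..2::real}"
    by (rule fundamental_theorem_of_calculus)
      (auto simp: has_real_derivative_iff_has_vector_derivative[symmetric]
        intro!: has_field_derivative_at_within[OF log_alt_deriv])
  then show ?thesis by (simp add: log_alt_1)
qed

context shift_system
begin

text \<open>Integrating the law over \<open>y\<close> in \<open>{1..2}\<close> turns the shift
  exponential into \<open>log_alt\<close>, which the alternating sum at \<open>2 * t\<close>
  produces as well. So the mean minus the alternating sum is halved when \<open>t\<close> doubles,
  up to remainders.\<close>

lemma mean_dilation:
  assumes a: "a > 0" "t \<ge> a" "t \<ge> t0" and int: "w 0 integrable_on {a..2 * t}"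
  shows "(\<lambda>y. rem t y 0) integrable_on {1..2}"
    and "1 / (2 * t) * integral {a..2 * t} (w 0) - (\<Sum>j\<le>m. (-1) ^ j * w j (2 * t)) =
      1/2 * (1 / t * integral {a..t} (w 0) - (\<Sum>j\<le>m. (-1) ^ j * w j t)) +
      1/2 * integral {1..2} (\<lambda>y. rem t y 0) - (\<Sum>j\<le>m. (-1) ^ j * rem t 2 j)"
proof -
  have t: "t > 0" using a by simp
  have "{1..2::real} = (\<lambda>x. x / t) ` {t..2 * t}"
  proof -
    have "x \<in> (\<lambda>x. x / t) ` {t..2 * t}" if "x \<in> {1..2}" for x
      using that t by (intro image_eqI[where x = "x * t"]) auto
    then show ?thesis using t by (auto simp: field_simps)
  qed
  moreover have "w 0 integrable_on {t..2 * t}"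
    by (rule integrable_on_subinterval[OF int]) (use a in auto)
  ultimately have dil: "((\<lambda>y. w 0 (y * t)) has_integral 1 / t * integral {t..2 * t} (w 0)) {1..2}"
    using has_integral_stretch_real[of "w 0" _ t "2 * t" t] t
    by (auto simp: has_integral_integral mult.commute)
  have sh: "((\<lambda>y. shift_exp m (ln y) (\<lambda>l. w l t) 0) has_integral
      (\<Sum>j\<le>m. (2 * log_alt j 2 - (-1) ^ j) * w j t)) {1..2}"
    unfolding shift_exp_def add_0 by (intro has_integral_sum has_integral_mult_left has_integral_ln_power) auto
  have r: "((\<lambda>y. rem t y 0) has_integral 1 / t * integral {t..2 * t} (w 0) -
      (\<Sum>j\<le>m. (2 * log_alt j 2 - (-1) ^ j) * w j t)) {1..2}"
    unfolding rem_def by (intro has_integral_diff dil sh)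
  then show "(\<lambda>y. rem t y 0) integrable_on {1..2}" by blast
  \<comment> \<open>The Cauchy product of the alternating series with the exponential series at
    \<open>ln 2\<close> has the coefficients \<open>log_alt l 2\<close>.\<close>
  have "(\<Sum>j\<le>m. (-1) ^ j * w j (2 * t)) - (\<Sum>j\<le>m. (-1) ^ j * rem t 2 j) =
      (\<Sum>j\<le>m. (-1) ^ j * (\<Sum>i\<le>m. ln 2 ^ i / fact i * w (0 + j + i) t))"
    by (simp add: rem_def shift_exp_def algebra_simps sum_subtractf)
  also have "\<dots> = (\<Sum>l\<le>m. log_alt l 2 * w (0 + l) t)"
    unfolding log_alt_def by (rule sum_shift_convolution) (use a w_zero in auto)
  finally have T2: "(\<Sum>j\<le>m. (-1) ^ j * w j (2 * t)) - (\<Sum>j\<le>m. (-1) ^ j * rem t 2 j) =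
      (\<Sum>l\<le>m. log_alt l 2 * w l t)" by simp
  then have T2': "(\<Sum>j\<le>m. (-1) ^ j * w j (2 * t)) =
      (\<Sum>l\<le>m. log_alt l 2 * w l t) + (\<Sum>j\<le>m. (-1) ^ j * rem t 2 j)" by linarith
  have split: "integral {a..2 * t} (w 0) = integral {a..t} (w 0) + integral {t..2 * t} (w 0)"
    by (rule Henstock_Kurzweil_Integration.integral_combine[symmetric]) (use a int in auto)
  have "(\<Sum>j\<le>m. (2 * log_alt j 2 - (-1) ^ j) * w j t) =
      2 * (\<Sum>l\<le>m. log_alt l 2 * w l t) - (\<Sum>j\<le>m. (-1) ^ j * w j t)"
    by (simp add: algebra_simps sum_subtractf sum_distrib_left)
  then have I: "integral {1..2} (\<lambda>y. rem t y 0) = 1 / t * integral {t..2 * t} (w 0) -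
      (2 * (\<Sum>l\<le>m. log_alt l 2 * w l t) - (\<Sum>j\<le>m. (-1) ^ j * w j t))"
    using integral_unique[OF r] by simp
  show "1 / (2 * t) * integral {a..2 * t} (w 0) - (\<Sum>j\<le>m. (-1) ^ j * w j (2 * t)) =
      1/2 * (1 / t * integral {a..t} (w 0) - (\<Sum>j\<le>m. (-1) ^ j * w j t)) +
      1/2 * integral {1..2} (\<lambda>y. rem t y 0) - (\<Sum>j\<le>m. (-1) ^ j * rem t 2 j)"
    unfolding T2' split I using t by (simp add: field_simps)
qed

lemma mean_asymp:
  assumes a: "a > 0" and int: "\<And>v. w 0 absolutely_integrable_on {a..v}"
  shows "((\<lambda>t. (1 / t * integral {a..t} (w 0) - (\<Sum>j\<le>m. (-1) ^ j * w j t)) / L t) \<longlongrightarrow> 0) at_top"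
proof -
  define D where "D t = 1 / t * integral {a..t} (w 0) - (\<Sum>j\<le>m. (-1) ^ j * w j t)" for t
  have int': "w 0 integrable_on {a..v}" for v
    using int set_lebesgue_integral_eq_integral(1) by blast
  have "((\<lambda>t. \<bar>D t / L t\<bar>) \<longlongrightarrow> 0) at_top"
  proof (rule tendsto_0_if_halving)
    fix e :: real assume e: "e > 0"
    \<comment> \<open>The remainders enter with total weight \<open>3/2\<close> and are then
      multiplied by \<open>L t / L (2 * t) \<le> 3/2\<close>; the factor \<open>4/9\<close>
      compensates exactly.\<close>
    then have "4/9 * e > 0" by simp
    from rem_uniform[OF this] L_doubling eventually_ge_at_top[of t0] eventually_ge_at_top[of a]
    show "\<forall>\<^sub>F t in at_top. \<bar>D (2 * t) / L (2 * t)\<bar> \<le> 3/4 * \<bar>D t / L t\<bar> + e"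
    proof eventually_elim
      case (elim t)
      let ?d = "4/9 * e * L t"
      have L: "L t > 0" "L (2 * t) > 0" "L t \<le> 3/2 * L (2 * t)"
        using elim L_pos dilate_ge[of t 2] by auto
      have S: "(\<Sum>j\<le>m. \<bar>rem t s j\<bar>) \<le> ?d" if "s \<in> {1..2}" for s
        using elim(1) that by auto
      note md = mean_dilation[OF a elim(4,3) int']
      have "norm (integral {1..2} (\<lambda>y. rem t y 0)) \<le> integral {1..2::real} (\<lambda>y. ?d)"
      proof (rule integral_norm_bound_integral[OF md(1)])
        fix s :: real assume "s \<in> {1..2}"
        have "\<bar>rem t s 0\<bar> \<le> (\<Sum>j\<le>m. \<bar>rem t s j\<bar>)" by (rule member_le_sum) auto
        then show "norm (rem t s 0) \<le> ?d" using S[OF \<open>s \<in> {1..2}\<close>] by simp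
      qed (rule integrable_const_ivl)
      then have i: "\<bar>integral {1..2} (\<lambda>y. rem t y 0)\<bar> \<le> ?d" by simp
      have "\<bar>\<Sum>j\<le>m. (-1) ^ j * rem t 2 j\<bar> \<le> (\<Sum>j\<le>m. \<bar>(-1) ^ j * rem t 2 j\<bar>)" by (rule sum_abs)
      also have "\<dots> \<le> ?d" using S[of 2] by (simp add: abs_mult power_abs)
      finally have "\<bar>\<Sum>j\<le>m. (-1) ^ j * rem t 2 j\<bar> \<le> ?d" .
      moreover have "D (2 * t) = 1/2 * D t + 1/2 * integral {1..2} (\<lambda>y. rem t y 0) -
          (\<Sum>j\<le>m. (-1) ^ j * rem t 2 j)"
        unfolding D_def by (rule md(2))
      ultimately have "\<bar>D (2 * t)\<bar> \<le> 1/2 * \<bar>D t\<bar> + 3/2 * ?d"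
        using i by linarith
      then have "\<bar>D (2 * t)\<bar> / L (2 * t) \<le> (1/2 * \<bar>D t\<bar> + 3/2 * ?d) / L (2 * t)"
        using L by (intro divide_right_mono) auto
      also have "\<dots> = (1/2 * (\<bar>D t\<bar> / L t) + 3/2 * (4/9 * e)) * (L t / L (2 * t))"
        using L by (simp add: field_simps)
      also have "\<dots> \<le> (1/2 * (\<bar>D t\<bar> / L t) + 3/2 * (4/9 * e)) * (3/2)"
        using L e by (intro mult_left_mono) (auto simp: field_simps)
      finally show ?case using L by (simp add: algebra_simps)
    qed
  next
    \<comment> \<open>For boundedness on a block any fixed tolerance serves: the law expresses
      \<open>w j (s * U)\<close> through the values at the single point \<open>U\<close>.\<close>
    have "(1::real) > 0" by simp
    from rem_uniform[OF this] L_doubling eventually_ge_at_top[of t0] eventually_ge_at_top[of a]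
    show "\<forall>\<^sub>F U in at_top. \<exists>C. \<forall>s\<in>{1..2}. \<bar>D (s * U) / L (s * U)\<bar> \<le> C"
    proof eventually_elim
      case (elim U)
      define W where "W = L U + (\<Sum>j\<le>m. 1 ^ j / fact j) * (\<Sum>l\<le>m. \<bar>w l U\<bar>)"
      define I where "I = integral {a..2 * U} (\<lambda>y. \<bar>w 0 y\<bar>)"
      have LU: "L U > 0" using elim L_pos by auto
      show ?case
      proof (intro exI ballI)
        fix s :: real assume s: "s \<in> {1..2}"
        have LsU: "L (s * U) > 0" "2/3 * L U \<le> L (s * U)"
          using elim(2)[rule_format, OF s] elim(3) s L_pos dilate_ge[of U s] by auto
        have sU: "s * U \<ge> a" "s * U \<le> 2 * U" using elim(4) a s mult_right_mono[of 1 s U]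
            mult_right_mono[of s 2 U] by (simp_all, linarith+)
        have w: "\<bar>w j (s * U)\<bar> \<le> W" if "j \<le> m" for j
        proof -
          have "\<bar>rem U s j\<bar> \<le> (\<Sum>k\<le>m. \<bar>rem U s k\<bar>)" using that by (intro member_le_sum) auto
          also have "\<dots> \<le> L U" using elim(1) s by auto
          finally have 1: "\<bar>rem U s j\<bar> \<le> L U" .
          have "\<bar>ln s\<bar> \<le> 1" using s ln_le_minus_one[of s] by auto
          then have "\<bar>shift_exp m (ln s) (\<lambda>l. w l U) j\<bar> \<le> (\<Sum>j\<le>m. 1 ^ j / fact j) * (\<Sum>l\<le>m. \<bar>w l U\<bar>)"
            using elim w_zero by (intro abs_shift_exp_le) auto
          then show ?thesis using 1 by (simp add: W_def rem_def)
        qed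
        have abs_int: "(\<lambda>y. \<bar>w 0 y\<bar>) integrable_on {a..v}" for v
          by (rule set_lebesgue_integral_eq_integral(1)[OF set_integrable_abs[OF int]])
        have "norm (integral {a..s * U} (w 0)) \<le> integral {a..s * U} (\<lambda>y. \<bar>w 0 y\<bar>)"
          by (rule integral_norm_bound_integral[OF int' abs_int]) simp
        also have "\<dots> \<le> I" unfolding I_def
          by (rule integral_subset_le[OF _ abs_int abs_int]) (use sU in auto)
        finally have "\<bar>integral {a..s * U} (w 0)\<bar> \<le> I" by simp
        moreover have "1 / (s * U) \<le> 1 / a" "0 \<le> 1 / (s * U)" using sU a by (auto simp: frac_le)
        ultimately have "\<bar>1 / (s * U) * integral {a..s * U} (w 0)\<bar> \<le> 1 / a * I"
          unfolding abs_mult using a by (intro mult_mono) auto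
        moreover have "\<bar>\<Sum>j\<le>m. (-1) ^ j * w j (s * U)\<bar> \<le> (\<Sum>j\<le>m. \<bar>(-1) ^ j * w j (s * U)\<bar>)"
          by (rule sum_abs)
        moreover have "\<dots> \<le> (\<Sum>j\<le>m. W)"
          by (rule sum_mono) (use w in \<open>auto simp: abs_mult power_abs\<close>)
        ultimately have "\<bar>D (s * U)\<bar> \<le> 1 / a * I + (\<Sum>j\<le>m. W)" unfolding D_def by linarith
        then show "\<bar>D (s * U) / L (s * U)\<bar> \<le> (1 / a * I + (\<Sum>j\<le>m. W)) / (2/3 * L U)"
          unfolding abs_divide using LU LsU by (intro frac_le) auto
      qed
    qed
  qed simp
  then show ?thesis unfolding D_def by (rule tendsto_rabs_zero_cancel)
qed

end

section \<open>Strictly upper triangular matrices\<close>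

definition strictly_upper :: "nat \<Rightarrow> real mat \<Rightarrow> bool" where
  "strictly_upper n A \<longleftrightarrow> A \<in> carrier_mat n n \<and> (\<forall>i<n. \<forall>j\<le>i. A $$ (i, j) = 0)"

lemma strictly_upper_carrier [dest]: "strictly_upper n A \<Longrightarrow> A \<in> carrier_mat n n"
  by (simp add: strictly_upper_def)

text \<open>Each further factor \<open>A\<close> pushes the nonzero entries at least one column to
  the right.\<close>

lemma strictly_upper_pow_eq_0:
  assumes A: "strictly_upper n A" and "i < n" "j < n" "j < i + k"
  shows "(A ^\<^sub>m k) $$ (i, j) = 0"
  using assms(2-)
proof (induction k arbitrary: j)
  case (Suc k)
  have cA: "A \<in> carrier_mat n n" using A by auto
  have "(A ^\<^sub>m k) $$ (i, l) * A $$ (l, j) = 0" if "l < n" for l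
  proof (cases "l < i + k")
    case True
    then show ?thesis using Suc that by simp
  next
    case False
    then have "j \<le> l" using Suc.prems by simp
    then show ?thesis using A that by (auto simp: strictly_upper_def)
  qed
  then show ?case using Suc.prems cA
    by (auto simp: scalar_prod_def intro!: sum.neutral)
next
  case 0
  have "dim_row A = n" using A by auto
  with 0 show ?case by simp
qed

lemma smult_pow_mat:
  fixes A :: "real mat"
  assumes "A \<in> carrier_mat n n"
  shows "(r \<cdot>\<^sub>m A) ^\<^sub>m k = r ^ k \<cdot>\<^sub>m A ^\<^sub>m k"
proof (induction k)
  case (Suc k)
  have "(r \<cdot>\<^sub>m A) ^\<^sub>m Suc k = (r ^ k \<cdot>\<^sub>m A ^\<^sub>m k) * (r \<cdot>\<^sub>m A)" by (simp add: Suc)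
  also have "\<dots> = r ^ k \<cdot>\<^sub>m (A ^\<^sub>m k * (r \<cdot>\<^sub>m A))"
    using assms by (intro mult_smult_assoc_mat) auto
  also have "A ^\<^sub>m k * (r \<cdot>\<^sub>m A) = r \<cdot>\<^sub>m (A ^\<^sub>m k * A)"
    using assms by (intro mult_smult_distrib) auto
  finally have eq: "(r \<cdot>\<^sub>m A) ^\<^sub>m Suc k = r ^ k \<cdot>\<^sub>m (r \<cdot>\<^sub>m (A ^\<^sub>m k * A))" .
  show ?case unfolding eq by (rule eq_matI) simp_all
next
  case 0
  show ?case by (rule eq_matI) simp_all
qed

lemma pow_mat_add:
  fixes A :: "real mat"
  assumes A: "A \<in> carrier_mat n n"
  shows "A ^\<^sub>m (k + l) = A ^\<^sub>m k * A ^\<^sub>m l"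
proof (induction l)
  case 0
  show ?case using A right_mult_one_mat[OF pow_carrier_mat[OF A]] by simp
next
  case (Suc l)
  show ?case
    using assoc_mult_mat[OF pow_carrier_mat[OF A] pow_carrier_mat[OF A] A] by (simp add: Suc)
qed

section \<open>Finite series for powers of \<open>x\<close> with nilpotent exponent and for their
  integrals\<close>

lemma mat_powr_entry:
  assumes A: "strictly_upper n A" and ij: "i < n" "j < n"
  shows "mat_powr x A $$ (i, j) = (\<Sum>k\<le>n. ln x ^ k / fact k * (A ^\<^sub>m k) $$ (i, j))"
proof -
  have cA: "A \<in> carrier_mat n n" using A by auto
  have e: "((ln x \<cdot>\<^sub>m A) ^\<^sub>m k) $$ (i, j) = ln x ^ k * (A ^\<^sub>m k) $$ (i, j)" for k
    using cA ij by (simp add: smult_pow_mat)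
  have "mat_powr x A $$ (i, j) = (\<Sum>k. ln x ^ k * (A ^\<^sub>m k) $$ (i, j) / fact k)"
    using cA ij by (simp add: mat_powr_def mat_exp_def e)
  also have "\<dots> = (\<Sum>k\<le>n. ln x ^ k * (A ^\<^sub>m k) $$ (i, j) / fact k)"
    by (rule suminf_finite) (use strictly_upper_pow_eq_0[OF A ij] ij in auto)
  finally show ?thesis by (simp add: algebra_simps)
qed

lemma mat_powr_carrier: "A \<in> carrier_mat n n \<Longrightarrow> mat_powr x A \<in> carrier_mat n n"
  by (simp add: mat_powr_def mat_exp_def)

lemma scalar_prod_mult_mat_vec:
  fixes p v :: "real vec"
  assumes "p \<in> carrier_vec n" "M \<in> carrier_mat n n" "v \<in> carrier_vec n"
  shows "p \<bullet> (M *\<^sub>v v) = (\<Sum>i<n. \<Sum>j<n. p $ i * M $$ (i, j) * v $ j)"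
  using assms by (simp add: scalar_prod_def sum_distrib_left atLeast0LessThan mult_ac)

text \<open>Passes from entrywise polynomials in \<open>A\<close> to scalar products; shared by
  \<open>mat_powr\<close>, \<open>Pi_coeff\<close> and the Neumann series.\<close>

lemma scalar_prod_power_sum:
  fixes p v :: "real vec"
  assumes "p \<in> carrier_vec n" "M \<in> carrier_mat n n" "v \<in> carrier_vec n" "A \<in> carrier_mat n n"
    and M: "\<And>i j. i < n \<Longrightarrow> j < n \<Longrightarrow> M $$ (i, j) = (\<Sum>k\<le>N. a k * (A ^\<^sub>m k) $$ (i, j))"
  shows "p \<bullet> (M *\<^sub>v v) = (\<Sum>k\<le>N. a k * (p \<bullet> (A ^\<^sub>m k *\<^sub>v v)))"
proof -
  have "p \<bullet> (M *\<^sub>v v) = (\<Sum>i<n. \<Sum>j<n. \<Sum>k\<le>N. a k * (p $ i * (A ^\<^sub>m k) $$ (i, j) * v $ j))"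
    using assms(1-3) by (simp add: scalar_prod_mult_mat_vec M sum_distrib_left sum_distrib_right mult_ac)
  also have "\<dots> = (\<Sum>i<n. \<Sum>k\<le>N. \<Sum>j<n. a k * (p $ i * (A ^\<^sub>m k) $$ (i, j) * v $ j))"
    by (intro sum.cong refl sum.swap)
  also have "\<dots> = (\<Sum>k\<le>N. \<Sum>i<n. \<Sum>j<n. a k * (p $ i * (A ^\<^sub>m k) $$ (i, j) * v $ j))"
    by (rule sum.swap)
  also have "\<dots> = (\<Sum>k\<le>N. a k * (p \<bullet> (A ^\<^sub>m k *\<^sub>v v)))"
    using assms(1,3,4) by (simp add: scalar_prod_mult_mat_vec sum_distrib_left mult_ac)
  finally show ?thesis .
qed

lemma scalar_prod_mat_powr:
  assumes "strictly_upper n A" "p \<in> carrier_vec n" "v \<in> carrier_vec n"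
  shows "p \<bullet> (mat_powr x A *\<^sub>v v) = (\<Sum>k\<le>n. ln x ^ k / fact k * (p \<bullet> (A ^\<^sub>m k *\<^sub>v v)))"
  using assms by (intro scalar_prod_power_sum[of _ n] mat_powr_carrier mat_powr_entry) auto

lemma strictly_upper_pow_large:
  assumes "strictly_upper n A" "k \<ge> n" "p \<in> carrier_vec n" "v \<in> carrier_vec n"
  shows "p \<bullet> (A ^\<^sub>m k *\<^sub>v v) = 0"
proof -
  have "A ^\<^sub>m k \<in> carrier_mat n n" using assms(1) by (intro pow_carrier_mat) auto
  then have "p \<bullet> (A ^\<^sub>m k *\<^sub>v v) = (\<Sum>i<n. \<Sum>j<n. p $ i * (A ^\<^sub>m k) $$ (i, j) * v $ j)"
    using assms by (intro scalar_prod_mult_mat_vec)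
  also have "\<dots> = 0"
  proof (intro sum.neutral ballI)
    fix i j assume "i \<in> {..<n}" "j \<in> {..<n}"
    then have "(A ^\<^sub>m k) $$ (i, j) = 0" using assms(2) by (intro strictly_upper_pow_eq_0[OF assms(1)]) auto
    then show "p $ i * (A ^\<^sub>m k) $$ (i, j) * v $ j = 0" by simp
  qed
  finally show ?thesis .
qed

text \<open>The fundamental theorem of calculus, applied to the finite logarithmic sum; the oriented
  integral covers \<open>x < 1\<close> too.\<close>

lemma LBINT_mat_powr_entry:
  assumes A: "strictly_upper n A" and ij: "i < n" "j < n" and x: "x > 0"
  shows "(LBINT y=ereal 1..ereal x. mat_powr y A $$ (i, j) / y) =
    (\<Sum>k\<le>n. ln x ^ Suc k / fact (Suc k) * (A ^\<^sub>m k) $$ (i, j))"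
proof -
  let ?F = "\<lambda>y. \<Sum>k\<le>n. ln y ^ Suc k / fact (Suc k) * (A ^\<^sub>m k) $$ (i, j)"
  have pos: "y > 0" if "y \<ge> min 1 x" for y using that x by auto
  have "(LBINT y=ereal 1..ereal x. (\<Sum>k\<le>n. ln y ^ k / fact k * (A ^\<^sub>m k) $$ (i, j)) / y) = ?F x - ?F 1"
  proof (rule interval_integral_FTC_finite)
    show "continuous_on {min 1 x..max 1 x} (\<lambda>y. (\<Sum>k\<le>n. ln y ^ k / fact k * (A ^\<^sub>m k) $$ (i, j)) / y)"
      using pos by (intro continuous_intros) force+
    fix y assume "min 1 x \<le> y" "y \<le> max 1 x"
    then have y: "y > 0" using pos by simp
    have "(?F has_real_derivative (\<Sum>k\<le>n. (1 + real k) * (1 / y * ln y ^ k) / fact (Suc k) * (A ^\<^sub>m k) $$ (i, j)))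
        (at y within {min 1 x..max 1 x})"
      by (intro DERIV_sum DERIV_cmult_right DERIV_cdivide DERIV_power_Suc
          has_field_derivative_at_within[OF DERIV_ln_divide[OF y]])
    also have "(\<Sum>k\<le>n. (1 + real k) * (1 / y * ln y ^ k) / fact (Suc k) * (A ^\<^sub>m k) $$ (i, j)) =
        (\<Sum>k\<le>n. ln y ^ k / fact k * (A ^\<^sub>m k) $$ (i, j)) / y"
      unfolding sum_divide_distrib by (rule sum.cong) (use y in \<open>auto simp: divide_simps\<close>)
    finally show "(?F has_vector_derivative (\<Sum>k\<le>n. ln y ^ k / fact k * (A ^\<^sub>m k) $$ (i, j)) / y)
        (at y within {min 1 x..max 1 x})"
      by (simp add: has_real_derivative_iff_has_vector_derivative)
  qed
  then show ?thesis by (simp add: mat_powr_entry[OF A ij])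
qed

lemma Pi_coeff_carrier: "Pi_coeff n A p x \<in> carrier_vec n"
  unfolding Pi_coeff_def by (rule carrier_vecI) simp

text \<open>The coefficient is a shift exponential without its term of index 0: the power
  \<open>Suc k\<close> of the logarithm goes with \<open>A ^\<^sub>m k\<close>. This is why
  \<open>f\<close> fits in front of the sequence of pairings.\<close>

lemma Pi_coeff_scalar_prod:
  assumes A: "strictly_upper n A" and p: "p \<in> carrier_vec n" and v: "v \<in> carrier_vec n" and x: "x > 0"
  shows "Pi_coeff n A p x \<bullet> v = (\<Sum>k\<le>n. ln x ^ Suc k / fact (Suc k) * (p \<bullet> (A ^\<^sub>m k *\<^sub>v v)))"
proof -
  let ?M = "mat n n (\<lambda>(i, j). LBINT y=ereal 1..ereal x. mat_powr y A $$ (i, j) / y)"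
  have "Pi_coeff n A p x \<bullet> v = p \<bullet> (?M *\<^sub>v v)"
    unfolding Pi_coeff_def by (rule transpose_vec_mult_scalar[of _ n n]) (use p v in auto)
  also have "\<dots> = (\<Sum>k\<le>n. ln x ^ Suc k / fact (Suc k) * (p \<bullet> (A ^\<^sub>m k *\<^sub>v v)))"
    using A p v by (intro scalar_prod_power_sum[of _ n]) (auto simp: LBINT_mat_powr_entry[OF A _ _ x])
  finally show ?thesis .
qed

text \<open>The row vector \<open>p (I + A)\<^sup>-\<^sup>1\<close> for strictly upper triangular \<open>A\<close>, by its Neumann series.\<close>

definition resolvent_vec :: "nat \<Rightarrow> real mat \<Rightarrow> real vec \<Rightarrow> real vec" where
  "resolvent_vec n A p =
     transpose_mat (mat n n (\<lambda>(i, j). \<Sum>k\<le>n. (-1) ^ k * (A ^\<^sub>m k) $$ (i, j))) *\<^sub>v p"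

lemma resolvent_vec_carrier [simp]: "resolvent_vec n A p \<in> carrier_vec n"
  unfolding resolvent_vec_def by (rule carrier_vecI) simp

lemma resolvent_vec_series:
  assumes A: "A \<in> carrier_mat n n" and p: "p \<in> carrier_vec n" and v: "v \<in> carrier_vec n"
  shows "resolvent_vec n A p \<bullet> v = (\<Sum>k\<le>n. (-1) ^ k * (p \<bullet> (A ^\<^sub>m k *\<^sub>v v)))"
proof -
  let ?G = "mat n n (\<lambda>(i, j). \<Sum>k\<le>n. (-1) ^ k * (A ^\<^sub>m k) $$ (i, j))"
  have "resolvent_vec n A p \<bullet> v = p \<bullet> (?G *\<^sub>v v)"
    unfolding resolvent_vec_def by (rule transpose_vec_mult_scalar[of _ n n]) (use p v in auto)
  also have "\<dots> = (\<Sum>k\<le>n. (-1) ^ k * (p \<bullet> (A ^\<^sub>m k *\<^sub>v v)))"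
    by (rule scalar_prod_power_sum[OF p _ v A]) simp_all
  finally show ?thesis .
qed

text \<open>The two alternating series telescope to their first term; the leftover contains
  \<open>A ^\<^sub>m Suc n\<close>, which vanishes.\<close>

lemma resolvent_vec_eq:
  assumes A: "strictly_upper n A" and p: "p \<in> carrier_vec n" and v: "v \<in> carrier_vec n"
  shows "resolvent_vec n A p \<bullet> v + resolvent_vec n A p \<bullet> (A *\<^sub>v v) = p \<bullet> v"
proof -
  have cA: "A \<in> carrier_mat n n" using A by auto
  have Av: "A *\<^sub>v v \<in> carrier_vec n" using cA v by simp
  let ?s = "\<lambda>k. (-1) ^ k * (p \<bullet> (A ^\<^sub>m k *\<^sub>v v))"
  have "resolvent_vec n A p \<bullet> (A *\<^sub>v v) = (\<Sum>k\<le>n. (-1) ^ k * (p \<bullet> (A ^\<^sub>m Suc k *\<^sub>v v)))"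
    unfolding resolvent_vec_series[OF cA p Av] using cA v
    by (intro sum.cong refl) (simp add: assoc_mult_mat_vec[of _ n n _ n])
  then have "resolvent_vec n A p \<bullet> v + resolvent_vec n A p \<bullet> (A *\<^sub>v v) = (\<Sum>k\<le>n. ?s k - ?s (Suc k))"
    unfolding resolvent_vec_series[OF cA p v] by (simp add: sum.distrib)
  also have "\<dots> = p \<bullet> v - ?s (Suc n)"
    using v cA by (subst sum_telescope) simp
  also have "p \<bullet> (A ^\<^sub>m Suc n *\<^sub>v v) = 0"
    using p v by (intro strictly_upper_pow_large[OF A]) auto
  finally show ?thesis by simp
qed

section \<open>The matrix \<open>K_mat n\<close> and the coefficient rows of the iterated
  means\<close>

lemma strictly_upper_K_mat: "strictly_upper n (K_mat n)"
  by (auto simp: strictly_upper_def K_mat_def)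

text \<open>The only possible eigenvalue is 0, so the condition on eigenvalues other than the
  smallest is vacuous.\<close>

lemma index_matrix_K_mat: "index_matrix n (K_mat n)"
proof -
  have c: "K_mat n \<in> carrier_mat n n" and u: "upper_triangular (K_mat n)"
    by (auto simp: K_mat_def)
  have "e = 0" if "e \<in> spectrum (K_mat n)" for e
  proof -
    have "0 = (\<Prod>a\<leftarrow>diag_mat (K_mat n). e - a)"
      using that unfolding spectrum_root_char_poly[OF c] char_poly_upper_triangular[OF c u]
      by (simp add: poly_prod_list o_def)
    then have "\<exists>a\<in>set (diag_mat (K_mat n)). e - a = 0"
      by (auto simp: prod_list_zero_iff)
    then show ?thesis by (auto simp: diag_mat_def K_mat_def)
  qed
  then have "spectrum (K_mat n) = {} \<or> spectrum (K_mat n) = {0}" by auto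
  then have "spectrum (K_mat n) - {Min (spectrum (K_mat n))} = {}" by (elim disjE) simp_all
  then have "\<forall>e\<in>spectrum (K_mat n) - {Min (spectrum (K_mat n))}. geometric_multiplicity (K_mat n) e = 1"
    by (simp only:) simp
  moreover have "\<forall>i j. i \<le> j \<longrightarrow> j < n \<longrightarrow> K_mat n $$ (j, j) \<le> K_mat n $$ (i, i)"
    by (simp add: K_mat_def)
  ultimately show ?thesis using c u unfolding index_matrix_def by blast
qed

text \<open>The rows \<open>c (I + B)^(-1)\<close>, then repeatedly multiplied on the right by
  \<open>B (I + B)^(-1)\<close>; the transpose expresses a row times \<open>B\<close>. Counting
  starts at 0, so row \<open>i\<close> belongs to \<open>mean_diff a f (Suc i)\<close>.\<close>

primrec mean_index :: "nat \<Rightarrow> real mat \<Rightarrow> real vec \<Rightarrow> nat \<Rightarrow> real vec" where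
  "mean_index n B c 0 = resolvent_vec n B c"
| "mean_index n B c (Suc i) = resolvent_vec n B (transpose_mat B *\<^sub>v mean_index n B c i)"

definition mean_mat :: "nat \<Rightarrow> real mat \<Rightarrow> real vec \<Rightarrow> real mat" where
  "mean_mat n B c = mat n n (\<lambda>(i, j). mean_index n B c i $ j)"

lemma mean_index_carrier [simp]: "mean_index n B c i \<in> carrier_vec n"
  by (cases i) simp_all

lemma dim_mean_index [simp]: "dim_vec (mean_index n B c i) = n"
  by (rule carrier_vecD) simp

lemma mean_mat_carrier [simp]: "mean_mat n B c \<in> carrier_mat n n"
  by (simp add: mean_mat_def)

lemma row_mean_mat: "i < n \<Longrightarrow> row (mean_mat n B c) i = mean_index n B c i"
  by (intro eq_vecI) (simp_all add: mean_mat_def)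

lemma mean_mat_mult_vec:
  assumes "i < n"
  shows "(mean_mat n B c *\<^sub>v v) $ i = mean_index n B c i \<bullet> v"
proof -
  have "i < dim_row (mean_mat n B c)" using assms by (simp add: mean_mat_def)
  then show ?thesis by (simp only: index_mult_mat_vec row_mean_mat[OF assms])
qed

lemma invertible_mat_iff_det:
  fixes A :: "real mat"
  assumes A: "A \<in> carrier_mat n n"
  shows "invertible_mat A \<longleftrightarrow> det A \<noteq> 0"
proof
  assume "invertible_mat A"
  then obtain A' where "inverts_mat A A'" "inverts_mat A' A"
    unfolding invertible_mat_def by blast
  then have A': "A * A' = 1\<^sub>m n" "A' * A = 1\<^sub>m (dim_row A')"
    using A unfolding inverts_mat_def by (simp_all only: carrier_matD)
  \<comment> \<open>\<open>invertible_mat\<close> leaves the size of \<open>A'\<close> open; the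
    dimensions of the two products determine it.\<close>
  have "dim_col (A * A') = n" "dim_col (A' * A) = dim_row A'"
    by (simp_all only: A' index_one_mat)
  then have "A' \<in> carrier_mat n n"
    using A by (intro carrier_matI) simp_all
  then have "det A * det A' = det (1\<^sub>m n)"
    using det_mult[OF A, of A'] A'(1) by simp
  then show "det A \<noteq> 0" by (metis det_one mult_zero_left zero_neq_one)
next
  assume "det A \<noteq> 0"
  from det_non_zero_imp_unit[OF A this, of "()"]
  obtain A' where "A' \<in> carrier_mat n n" "A' * A = 1\<^sub>m n" "A * A' = 1\<^sub>m n"
    unfolding Units_def ring_mat_def by auto
  then have "inverts_mat A A'" "inverts_mat A' A"
    using A unfolding inverts_mat_def by (simp_all only: carrier_matD)
  then show "invertible_mat A" using A unfolding invertible_mat_def by auto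
qed

lemma mult_mat_vec_index_sum:
  fixes A :: "real mat"
  assumes "A \<in> carrier_mat n n" "v \<in> carrier_vec n" "i < n"
  shows "(A *\<^sub>v v) $ i = (\<Sum>j<n. A $$ (i, j) * v $ j)"
  using assms by (simp add: scalar_prod_def atLeast0LessThan)

lemma strictly_upper_coord:
  assumes A: "strictly_upper n A" and q: "q \<in> carrier_vec n" and j: "j < n"
  shows "q \<bullet> (A *\<^sub>v unit_vec n j) = (\<Sum>l<j. q $ l * A $$ (l, j))"
proof -
  have "q \<bullet> (A *\<^sub>v unit_vec n j) = (\<Sum>l<n. \<Sum>k<n. q $ l * A $$ (l, k) * unit_vec n j $ k)"
    using A q by (intro scalar_prod_mult_mat_vec) auto
  also have "\<dots> = (\<Sum>l<n. q $ l * A $$ (l, j))"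
    using j by (intro sum.cong refl) (simp add: unit_vec_def if_distrib[of "\<lambda>x. _ * x"] cong: if_cong)
  also have "\<dots> = (\<Sum>l<j. q $ l * A $$ (l, j))"
    using A j by (intro sum.mono_neutral_right) (auto simp: strictly_upper_def)
  finally show ?thesis .
qed

context
  fixes n :: nat and B :: "real mat" and c :: "real vec"
  assumes n: "n \<ge> 1" and B: "strictly_upper n B" and c: "c \<in> carrier_vec n"
begin

lemma B_carrier: "B \<in> carrier_mat n n"
  using B by auto

lemma mean_index_0_eq:
  "v \<in> carrier_vec n \<Longrightarrow> mean_index n B c 0 \<bullet> v + mean_index n B c 0 \<bullet> (B *\<^sub>v v) = c \<bullet> v"
  using resolvent_vec_eq[OF B c] by simp

lemma mean_index_Suc_eq:
  assumes v: "v \<in> carrier_vec n"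
  shows "mean_index n B c (Suc i) \<bullet> v + mean_index n B c (Suc i) \<bullet> (B *\<^sub>v v) =
    mean_index n B c i \<bullet> (B *\<^sub>v v)"
proof -
  have "transpose_mat B *\<^sub>v mean_index n B c i \<in> carrier_vec n"
    using B_carrier by (intro mult_mat_vec_carrier[of _ n n]) auto
  from resolvent_vec_eq[OF B this v] transpose_vec_mult_scalar[OF B_carrier v mean_index_carrier]
  show ?thesis by simp
qed

text \<open>From one row to the next, \<open>B\<close> moves the leading position one place to the
  right and contributes a superdiagonal entry, while \<open>(I + B)^(-1)\<close> is unit upper
  triangular and leaves the leading coefficient alone.\<close>

lemma mean_index_coord:
  "i < n \<Longrightarrow> (\<forall>j<i. mean_index n B c i $ j = 0) \<and>
     mean_index n B c i $ i = c $ 0 * (\<Prod>l<i. B $$ (l, Suc l))"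
proof (induction i)
  case 0
  then show ?case using mean_index_0_eq[of "unit_vec n 0"] c
    by (simp add: strictly_upper_coord[OF B] scalar_prod_right_unit)
next
  case (Suc i)
  define q r where "q = mean_index n B c (Suc i)" and "r = mean_index n B c i"
  have carrier: "q \<in> carrier_vec n" "r \<in> carrier_vec n" unfolding q_def r_def by auto
  have r: "\<forall>j<i. r $ j = 0" "r $ i = c $ 0 * (\<Prod>l<i. B $$ (l, Suc l))"
    using Suc unfolding r_def by auto
  \<comment> \<open>Testing the recursion on unit vectors gives a triangular system for the
    coordinates of \<open>q\<close>.\<close>
  have eq: "q $ j + (\<Sum>l<j. q $ l * B $$ (l, j)) = (\<Sum>l<j. r $ l * B $$ (l, j))" if "j < n" for j
    using mean_index_Suc_eq[of "unit_vec n j" i] that carrier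
    by (simp add: strictly_upper_coord[OF B] scalar_prod_right_unit
        flip: q_def r_def del: mean_index.simps)
  have zero: "q $ j = 0" if "j < Suc i" for j
    using that
  proof (induction j rule: less_induct)
    case (less j)
    have "(\<Sum>l<j. q $ l * B $$ (l, j)) = 0" "(\<Sum>l<j. r $ l * B $$ (l, j)) = 0"
      using less r by (auto intro!: sum.neutral)
    then show ?case using eq[of j] less.prems Suc.prems by simp
  qed
  have "q $ Suc i + (\<Sum>l<Suc i. q $ l * B $$ (l, Suc i)) = (\<Sum>l<Suc i. r $ l * B $$ (l, Suc i))"
    by (rule eq) (rule Suc.prems)
  then have "q $ Suc i = r $ i * B $$ (i, Suc i)"
    using zero r(1) by simp
  then show ?case using zero r(2) unfolding q_def by simp
qed

lemma mean_mat_upper_triangular: "upper_triangular (mean_mat n B c)"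
  unfolding upper_triangular_def mean_mat_def using mean_index_coord by auto

lemma mean_mat_diag: "i < n \<Longrightarrow> mean_mat n B c $$ (i, i) = c $ 0 * (\<Prod>l<i. B $$ (l, Suc l))"
  by (simp add: mean_mat_def mean_index_coord)

text \<open>The determinant is the product of the diagonal, and the last diagonal entry contains
  every factor of the others, so it alone decides.\<close>

lemma invertible_mean_mat:
  "invertible_mat (mean_mat n B c) \<longleftrightarrow> c $ 0 * (\<Prod>i<n - 1. B $$ (i, Suc i)) \<noteq> 0"
proof -
  have "det (mean_mat n B c) \<noteq> 0 \<longleftrightarrow> (\<forall>i<n. mean_mat n B c $$ (i, i) \<noteq> 0)"
    unfolding det_upper_triangular[OF mean_mat_upper_triangular mean_mat_carrier]
    by (auto simp: prod_list_zero_iff diag_mat_def mean_mat_def)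
  also have "\<dots> \<longleftrightarrow> c $ 0 * (\<Prod>i<n - 1. B $$ (i, Suc i)) \<noteq> 0"
  proof
    assume "\<forall>i<n. mean_mat n B c $$ (i, i) \<noteq> 0"
    then show "c $ 0 * (\<Prod>i<n - 1. B $$ (i, Suc i)) \<noteq> 0"
      using n by (auto simp: mean_mat_diag dest!: spec[of _ "n - 1"])
  qed (auto simp: mean_mat_diag)
  finally show ?thesis unfolding invertible_mat_iff_det[OF mean_mat_carrier] .
qed

text \<open>This row is supported on its last coordinate, where it meets the zero last row of
  \<open>B\<close>.\<close>

lemma mean_index_last:
  assumes v: "v \<in> carrier_vec n"
  shows "mean_index n B c (n - 1) \<bullet> (B *\<^sub>v v) = 0"
proof -
  have "mean_index n B c (n - 1) $ i * B $$ (i, j) * v $ j = 0" if "i < n" "j < n" for i j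
  proof (cases "i < n - 1")
    case True
    then show ?thesis using mean_index_coord[of "n - 1"] n by simp
  next
    case False
    then have "j \<le> i" using that by simp
    then show ?thesis using B that by (simp add: strictly_upper_def)
  qed
  then show ?thesis using v B_carrier
    by (subst scalar_prod_mult_mat_vec[of _ n]) (auto intro!: sum.neutral)
qed

text \<open>Downward induction from the last row, unrolling
  \<open>q_i B = q_(i+1) + q_(i+1) B\<close>. This is row \<open>i\<close> of
  \<open>Q B = K Q\<close>.\<close>

lemma mean_index_shift:
  assumes v: "v \<in> carrier_vec n" and "i \<le> n - 1"
  shows "mean_index n B c i \<bullet> (B *\<^sub>v v) = (\<Sum>j\<in>{Suc i..<n}. mean_index n B c j \<bullet> v)"
  using assms(2)
proof (induction i rule: inc_induct)
  case base
  then show ?case using mean_index_last[OF v] n by simp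
next
  case (step i)
  then have "{Suc i..<n} = insert (Suc i) {Suc (Suc i)..<n}" by auto
  then show ?case using step.IH mean_index_Suc_eq[OF v, of i] by simp
qed

text \<open>Substituting row 0 of \<open>Q B = K Q\<close> into \<open>q_0 + q_0 B = c\<close>
  yields \<open>(1, ..., 1) Q = c\<close>.\<close>

lemma mean_index_sum:
  assumes v: "v \<in> carrier_vec n"
  shows "(\<Sum>j<n. mean_index n B c j \<bullet> v) = c \<bullet> v"
proof -
  have "{..<n} = insert 0 {Suc 0..<n}" using n by auto
  then show ?thesis using mean_index_0_eq[OF v] mean_index_shift[OF v, of 0] by simp
qed

lemma K_mat_pow_mean_mat:
  assumes "v \<in> carrier_vec n"
  shows "K_mat n ^\<^sub>m k *\<^sub>v (mean_mat n B c *\<^sub>v v) = mean_mat n B c *\<^sub>v (B ^\<^sub>m k *\<^sub>v v)"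
  using assms
proof (induction k arbitrary: v)
  case 0
  then have "mean_mat n B c *\<^sub>v v \<in> carrier_vec n"
    by (intro mult_mat_vec_carrier[OF mean_mat_carrier])
  then show ?case using 0 B_carrier by (simp add: K_mat_def one_mult_mat_vec)
next
  case (Suc k)
  let ?Q = "mean_mat n B c"
  have K: "K_mat n \<in> carrier_mat n n" by (simp add: K_mat_def)
  have Qv: "?Q *\<^sub>v v \<in> carrier_vec n" by (rule mult_mat_vec_carrier[OF mean_mat_carrier Suc.prems])
  have Bv: "B *\<^sub>v v \<in> carrier_vec n" by (rule mult_mat_vec_carrier[OF B_carrier Suc.prems])
  have "K_mat n *\<^sub>v (?Q *\<^sub>v v) = ?Q *\<^sub>v (B *\<^sub>v v)"
  proof (rule eq_vecI)
    fix i assume "i < dim_vec (?Q *\<^sub>v (B *\<^sub>v v))"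
    then have i: "i < n" by (simp add: mean_mat_def)
    have "(K_mat n *\<^sub>v (?Q *\<^sub>v v)) $ i = (\<Sum>j<n. K_mat n $$ (i, j) * (mean_index n B c j \<bullet> v))"
      unfolding mult_mat_vec_index_sum[OF K Qv i]
      by (rule sum.cong) (auto simp: mean_mat_mult_vec)
    also have "\<dots> = (\<Sum>j\<in>{Suc i..<n}. K_mat n $$ (i, j) * (mean_index n B c j \<bullet> v))"
      using i by (intro sum.mono_neutral_right) (auto simp: K_mat_def)
    also have "\<dots> = (\<Sum>j\<in>{Suc i..<n}. mean_index n B c j \<bullet> v)"
      by (rule sum.cong) (auto simp: K_mat_def)
    also have "\<dots> = (?Q *\<^sub>v (B *\<^sub>v v)) $ i"
      using i mean_index_shift[OF Suc.prems, of i] by (simp add: mean_mat_mult_vec)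
    finally show "(K_mat n *\<^sub>v (?Q *\<^sub>v v)) $ i = (?Q *\<^sub>v (B *\<^sub>v v)) $ i" .
  qed (simp add: K_mat_def mean_mat_def)
  then show ?case
    using Suc.IH[OF Bv] Suc.prems K Qv B_carrier
    by (simp add: assoc_mult_mat_vec[of _ n n _ n] pow_carrier_mat)
qed

end

section \<open>Iterated means\<close>

lemma measurable_on_half_line:
  fixes u :: "real \<Rightarrow> real"
  assumes "\<And>v. u \<in> borel_measurable (lebesgue_on {a..v})"
  shows "u \<in> borel_measurable (lebesgue_on {a..})"
proof (rule measurable_piecewise_restrict2[where A = "\<lambda>k. {a..a + real k}"])
  show "{a..a + real k} \<in> sets (lebesgue_on {a..})" for k
    by (subst sets_restrict_space_iff) auto
  show "space (lebesgue_on {a..}) = (\<Union>k. {a..a + real k})"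
  proof -
    have "\<exists>k. x \<le> a + real k" for x
      using real_arch_simple[of "x - a"] by (auto simp: algebra_simps)
    then show ?thesis by auto
  qed
  fix k :: nat
  have "(\<lambda>x. if x \<in> {a..a + real k} then u x else 0) \<in> borel_measurable lebesgue"
    by (rule borel_measurable_if_I) (use assms in auto)
  then have "(\<lambda>x. if x \<in> {a..a + real k} then u x else 0) \<in> borel_measurable (lebesgue_on {a..})"
    by (rule measurable_restrict_space1)
  then show "\<exists>h\<in>borel_measurable (lebesgue_on {a..}). \<forall>x\<in>{a..a + real k}. u x = h x"
    by (rule bexI[rotated]) auto
qed

lemma set_lebesgue_integral_eq:
  fixes u :: "real \<Rightarrow> real"
  assumes "u absolutely_integrable_on {a..t}"
  shows "(LINT y:{a..t}|lebesgue. u y) = integral {a..t} u"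
  using set_lebesgue_integral_eq_integral(2)[OF assms] .

text \<open>The subtracted mean is continuous on \<open>{a..v}\<close>, as \<open>a > 0\<close>
  keeps \<open>1 / t\<close> continuous, so the recursion preserves absolute integrability.\<close>

lemma mean_diff_absolutely_integrable:
  assumes "a > 0" and f: "locally_integrable_from a f"
  shows "mean_diff a f i absolutely_integrable_on {a..v}"
proof (induction i arbitrary: v)
  case 0
  then show ?case using f by (auto simp: locally_integrable_from_def)
next
  case (Suc i)
  have "continuous_on {a..v} (\<lambda>t. 1 / t * integral {a..t} (mean_diff a f i))"
    using \<open>a > 0\<close> set_lebesgue_integral_eq_integral(1)[OF Suc.IH]
    by (intro continuous_intros indefinite_integral_continuous_1) auto
  then have "(\<lambda>t. 1 / t * integral {a..t} (mean_diff a f i)) absolutely_integrable_on {a..v}"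
    by (rule absolutely_integrable_continuous_real)
  from set_integral_diff(1)[OF Suc.IH this] show ?case
    by (simp add: set_lebesgue_integral_eq[OF Suc.IH])
qed

lemma mean_diff_measurable:
  assumes "a > 0" and "locally_integrable_from a f"
  shows "mean_diff a f i \<in> borel_measurable (lebesgue_on {a..})"
  by (intro measurable_on_half_line absolutely_integrable_imp_borel_measurable
      mean_diff_absolutely_integrable assms) auto

section \<open>Scalar consequences of regular variation with a nilpotent index matrix\<close>

locale rv_zero_diagonal =
  fixes n :: nat and B :: "real mat" and D :: "real set" and g :: "real \<Rightarrow> real vec"
  assumes n: "n \<ge> 1" and B: "strictly_upper n B" and rv: "regularly_varying D n B g"
begin

abbreviation gl :: "real \<Rightarrow> real" where "gl \<equiv> \<lambda>t. g t $ (n - 1)"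

lemma carrier_B: "B \<in> carrier_mat n n"
  using B by auto

lemma D_half_line: obtains t0 where "{t0..} \<subseteq> D"
  using rv by (auto simp: regularly_varying_def rate_vector_def nbhd_infinity_def)

lemma g_carrier: "t \<in> D \<Longrightarrow> g t \<in> carrier_vec n"
  using rv by (auto simp: regularly_varying_def rate_vector_def)

lemma eventually_D: "\<forall>\<^sub>F t in at_top. t \<in> D"
proof -
  obtain t0 where "{t0..} \<subseteq> D" by (rule D_half_line)
  then show ?thesis unfolding eventually_at_top_linorder by (intro exI[of _ t0]) auto
qed

lemma filterlim_dilate: "x > 0 \<Longrightarrow> filterlim (\<lambda>t::real. x * t) at_top at_top"
  by (rule filterlim_tendsto_pos_mult_at_top[OF tendsto_const _ filterlim_ident])

lemma eventually_D_dilate: "x > 0 \<Longrightarrow> \<forall>\<^sub>F t in at_top. x * t \<in> D"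
  using eventually_compose_filterlim[OF eventually_D filterlim_dilate] .

lemma eventually_gl_nonzero: "\<forall>\<^sub>F t in at_top. gl t \<noteq> 0"
proof -
  have "eventually_constant_sign gl"
    using rv n by (auto simp: regularly_varying_def rate_vector_def)
  then show ?thesis unfolding eventually_constant_sign_def
    by (auto elim: eventually_mono)
qed

lemma scalar_prod_small:
  assumes p: "p \<in> carrier_vec n" and u: "\<And>i. i < n \<Longrightarrow> (\<lambda>t. u t $ i) \<in> o(gl)"
    and dim: "\<forall>\<^sub>F t in at_top. u t \<in> carrier_vec n"
  shows "(\<lambda>t. p \<bullet> u t) \<in> o(gl)"
proof -
  have "(\<lambda>t. \<Sum>i<n. p $ i * u t $ i) \<in> o(gl)"
    using u by (intro big_sum_in_smallo) (auto intro: landau_o.small.mult_in_1)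
  moreover have "\<forall>\<^sub>F t in at_top. (\<Sum>i<n. p $ i * u t $ i) = p \<bullet> u t"
    using dim by eventually_elim (simp add: scalar_prod_def atLeast0LessThan)
  ultimately show ?thesis by (simp add: landau_o.small.in_cong)
qed

text \<open>Pairing with an arbitrary row \<open>p\<close> replaces the vector law by scalar laws
  whose matrix power is a finite logarithmic sum.\<close>

lemma g_dilate:
  assumes p: "p \<in> carrier_vec n" and x: "x > 0"
  shows "(\<lambda>t. p \<bullet> g (x * t) - (\<Sum>k\<le>n. ln x ^ k / fact k * (p \<bullet> (B ^\<^sub>m k *\<^sub>v g t)))) \<in> o(gl)"
proof -
  have pw: "mat_powr x B \<in> carrier_mat n n" by (rule mat_powr_carrier[OF carrier_B])
  have "(\<lambda>t. p \<bullet> (g (x * t) - mat_powr x B *\<^sub>v g t)) \<in> o(gl)"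
  proof (rule scalar_prod_small[OF p])
    show "(\<lambda>t. (g (x * t) - mat_powr x B *\<^sub>v g t) $ i) \<in> o(gl)" if "i < n" for i
      using rv x that by (auto simp: regularly_varying_def vec_smallo_last_def)
    show "\<forall>\<^sub>F t in at_top. g (x * t) - mat_powr x B *\<^sub>v g t \<in> carrier_vec n"
      using eventually_D eventually_D_dilate[OF x]
      by eventually_elim (use pw g_carrier in \<open>auto intro!: minus_carrier_vec mult_mat_vec_carrier\<close>)
  qed
  moreover have "\<forall>\<^sub>F t in at_top. p \<bullet> (g (x * t) - mat_powr x B *\<^sub>v g t) =
      p \<bullet> g (x * t) - (\<Sum>k\<le>n. ln x ^ k / fact k * (p \<bullet> (B ^\<^sub>m k *\<^sub>v g t)))"
    using eventually_D eventually_D_dilate[OF x]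
  proof eventually_elim
    case (elim t)
    have "p \<bullet> (g (x * t) - mat_powr x B *\<^sub>v g t) = p \<bullet> g (x * t) - p \<bullet> (mat_powr x B *\<^sub>v g t)"
      by (rule scalar_prod_minus_distrib[OF p]) (use elim pw g_carrier in \<open>auto intro!: mult_mat_vec_carrier\<close>)
    then show ?case using scalar_prod_mat_powr[OF B p g_carrier[OF elim(1)]] by simp
  qed
  ultimately show ?thesis by (simp add: landau_o.small.in_cong)
qed

text \<open>The last row of every positive power of \<open>B\<close> is zero, so under dilation the
  last component only reproduces itself.\<close>

lemma gl_slow:
  assumes x: "x > 0"
  shows "((\<lambda>t. gl (x * t) / gl t) \<longlongrightarrow> 1) at_top"
proof -
  let ?p = "unit_vec n (n - 1) :: real vec"
  have "(\<lambda>t. ?p \<bullet> g (x * t) - (\<Sum>k\<le>n. ln x ^ k / fact k * (?p \<bullet> (B ^\<^sub>m k *\<^sub>v g t)))) \<in> o(gl)"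
    by (rule g_dilate[OF _ x]) simp
  moreover have "\<forall>\<^sub>F t in at_top. ?p \<bullet> g (x * t) -
      (\<Sum>k\<le>n. ln x ^ k / fact k * (?p \<bullet> (B ^\<^sub>m k *\<^sub>v g t))) = gl (x * t) - gl t"
    using eventually_D eventually_D_dilate[OF x]
  proof eventually_elim
    case (elim t)
    have gt: "g t \<in> carrier_vec n" "g (x * t) \<in> carrier_vec n" using elim g_carrier by auto
    have p: "?p \<bullet> v = v $ (n - 1)" if "v \<in> carrier_vec n" for v
      using that n by (intro scalar_prod_left_unit) auto
    have pk: "?p \<bullet> (B ^\<^sub>m k *\<^sub>v g t) = (if k = 0 then gl t else 0)" for k
    proof (cases "k = 0")
      case True
      then show ?thesis using p gt carrier_B by (simp add: one_mult_mat_vec)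
    next
      case False
      have Bk: "B ^\<^sub>m k \<in> carrier_mat n n" by (rule pow_carrier_mat[OF carrier_B])
      have "?p \<bullet> (B ^\<^sub>m k *\<^sub>v g t) = (\<Sum>j<n. (B ^\<^sub>m k) $$ (n - 1, j) * g t $ j)"
        using p[OF mult_mat_vec_carrier[OF Bk gt(1)]] mult_mat_vec_index_sum[OF Bk gt(1)] n by simp
      also have "\<dots> = 0"
        using False n by (intro sum.neutral ballI) (simp add: strictly_upper_pow_eq_0[OF B])
      finally show ?thesis using False by simp
    qed
    have "(\<Sum>k\<le>n. ln x ^ k / fact k * (?p \<bullet> (B ^\<^sub>m k *\<^sub>v g t))) = (\<Sum>k\<le>n. if k = 0 then gl t else 0)"
      unfolding pk by (rule sum.cong) auto
    then show ?case using p[OF gt(2)] by simp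
  qed
  ultimately have "(\<lambda>t. gl (x * t) - gl t) \<in> o(gl)"
    by (simp add: landau_o.small.in_cong)
  from tendsto_add[OF smalloD_tendsto[OF this] tendsto_const[of 1]]
  have "((\<lambda>t. (gl (x * t) - gl t) / gl t + 1) \<longlongrightarrow> 1) at_top" by simp
  moreover have "\<forall>\<^sub>F t in at_top. (gl (x * t) - gl t) / gl t + 1 = gl (x * t) / gl t"
    using eventually_gl_nonzero by eventually_elim (simp add: field_simps)
  ultimately show ?thesis by (simp add: tendsto_cong)
qed

lemma small_dilate:
  assumes "u \<in> o(gl)" and x: "x > 0"
  shows "(\<lambda>t. u (x * t)) \<in> o(gl)"
proof (rule smalloI_tendsto[OF _ eventually_gl_nonzero])
  have "((\<lambda>t. u (x * t) / gl (x * t) * (gl (x * t) / gl t)) \<longlongrightarrow> 0) at_top"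
    using tendsto_mult[OF filterlim_compose[OF smalloD_tendsto[OF assms(1)] filterlim_dilate[OF x]] gl_slow[OF x]]
    by (simp only: mult_zero_left)
  moreover have "\<forall>\<^sub>F t in at_top. u (x * t) / gl (x * t) * (gl (x * t) / gl t) = u (x * t) / gl t"
    using eventually_compose_filterlim[OF eventually_gl_nonzero filterlim_dilate[OF x]]
    by eventually_elim simp
  ultimately show "((\<lambda>t. u (x * t) / gl t) \<longlongrightarrow> 0) at_top"
    by (rule Lim_transform_eventually)
qed

lemma gl_measurable:
  assumes "i < n" "{t0..} \<subseteq> D"
  shows "(\<lambda>t. g t $ i) \<in> borel_measurable (lebesgue_on {t0..})"
  using rv assms by (intro measurable_restrict_mono[OF _ assms(2)]) (auto simp: regularly_varying_def)

text \<open>The mean of \<open>F\<close> is asymptotic to an alternating sum starting with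
  \<open>F\<close> itself, so the difference of the two leaves the Neumann series of
  \<open>resolvent_vec\<close>.\<close>

lemma mean_step:
  assumes a: "a > 0" and F: "\<And>v. F absolutely_integrable_on {a..v}"
    and p: "p \<in> carrier_vec n"
    and F_lim: "\<And>x. x \<ge> 1 \<Longrightarrow> (\<lambda>t. F (x * t) - F t -
      (\<Sum>k\<le>n. ln x ^ Suc k / fact (Suc k) * (p \<bullet> (B ^\<^sub>m k *\<^sub>v g t)))) \<in> o(gl)"
  shows "(\<lambda>t. F t - 1 / t * (LINT y:{a..t}|lebesgue. F y) - resolvent_vec n B p \<bullet> g t) \<in> o(gl)"
proof -
  have Bk: "B ^\<^sub>m k \<in> carrier_mat n n" for k by (rule pow_carrier_mat[OF carrier_B])
  obtain t1 where t1: "{t1..} \<subseteq> D" by (rule D_half_line)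
  obtain t2 where t2: "\<And>t. t \<ge> t2 \<Longrightarrow> gl t \<noteq> 0"
    using eventually_gl_nonzero unfolding eventually_at_top_linorder by blast
  define t0 where "t0 = Max {a, t1, t2}"
  have t0: "t0 \<ge> a" "t0 \<ge> t1" "t0 \<ge> t2" by (auto simp: t0_def)
  have t0D: "{t0..} \<subseteq> D" using t0 t1 by auto
  have gt: "g t \<in> carrier_vec n" if "t \<ge> t0" for t using that t0D g_carrier by auto
  define s where "s k t = p \<bullet> (B ^\<^sub>m k *\<^sub>v g t)" for k t
  \<comment> \<open>Placing \<open>F\<close> in front of the pairings shifts their indices by one,
    whence the cutoff \<open>Suc n\<close> below.\<close>
  define w where "w k t = (case k of 0 \<Rightarrow> F t | Suc k \<Rightarrow> s k t)" for k t
  have w_simps: "w 0 = F" "w (Suc k) = s k" for k by (simp_all add: w_def fun_eq_iff)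
  have s_zero: "s k t = 0" if "k \<ge> n" "t \<ge> t0" for k t
    unfolding s_def by (rule strictly_upper_pow_large[OF B that(1) p gt[OF that(2)]])
  have w_lim: "(\<lambda>t. w k (x * t) - shift_exp (Suc n) (ln x) (\<lambda>l. w l t) k) \<in> o(gl)" if x: "x \<ge> 1" for k x
  proof (cases k)
    case 0
    have "shift_exp (Suc n) (ln x) (\<lambda>l. w l t) 0 =
        F t + (\<Sum>k\<le>n. ln x ^ Suc k / fact (Suc k) * (p \<bullet> (B ^\<^sub>m k *\<^sub>v g t)))" for t
      unfolding shift_exp_def sum.atMost_Suc_shift by (simp add: w_simps s_def del: fact_Suc power_Suc)
    then show ?thesis using F_lim[OF x] 0 by (simp add: w_simps diff_diff_eq del: fact_Suc power_Suc)
  next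
    case (Suc i)
    \<comment> \<open>Absorbing \<open>B ^\<^sub>m i\<close> into the row reduces the law for
      \<open>w (Suc i)\<close> to regular variation of \<open>g\<close> tested with
      \<open>p'\<close>.\<close>
    define p' where "p' = transpose_mat (B ^\<^sub>m i) *\<^sub>v p"
    have p': "p' \<in> carrier_vec n" unfolding p'_def using Bk p
      by (intro mult_mat_vec_carrier[of _ n n]) auto
    have p'v: "p' \<bullet> v = p \<bullet> (B ^\<^sub>m i *\<^sub>v v)" if "v \<in> carrier_vec n" for v
      unfolding p'_def by (rule transpose_vec_mult_scalar[OF Bk that p])
    have p's: "p' \<bullet> (B ^\<^sub>m j *\<^sub>v g t) = s (i + j) t" if "t \<ge> t0" for j t
      using p'v[OF mult_mat_vec_carrier[OF Bk gt[OF that]]] assoc_mult_mat_vec[OF Bk Bk gt[OF that]]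
        pow_mat_add[OF carrier_B] by (simp add: s_def)
    have "\<forall>\<^sub>F t in at_top. p' \<bullet> g (x * t) - (\<Sum>k\<le>n. ln x ^ k / fact k * (p' \<bullet> (B ^\<^sub>m k *\<^sub>v g t))) =
        w k (x * t) - shift_exp (Suc n) (ln x) (\<lambda>l. w l t) k"
      using eventually_ge_at_top[of t0]
    proof eventually_elim
      case (elim t)
      have "1 * t \<le> x * t" using x elim t0 a by (intro mult_right_mono) auto
      then have "t0 \<le> x * t" using elim by linarith
      then have "p' \<bullet> g (x * t) = s i (x * t)" using p'v gt by (simp add: s_def)
      moreover have "shift_exp (Suc n) (ln x) (\<lambda>l. w l t) k = (\<Sum>k\<le>n. ln x ^ k / fact k * s (i + k) t)"
        using s_zero[of "i + Suc n" t] elim by (simp add: shift_exp_def Suc w_simps)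
      ultimately show ?case using p's[OF elim] Suc by (simp add: w_simps)
    qed
    moreover have "(\<lambda>t. p' \<bullet> g (x * t) - (\<Sum>k\<le>n. ln x ^ k / fact k * (p' \<bullet> (B ^\<^sub>m k *\<^sub>v g t)))) \<in> o(gl)"
      by (rule g_dilate[OF p']) (use x in auto)
    ultimately show ?thesis by (simp add: landau_o.small.in_cong)
  qed
  interpret shift_system "Suc n" t0 "\<lambda>t. \<bar>gl t\<bar>" w
  proof
    show "t0 > 0" using a t0 by simp
    show "\<bar>gl t\<bar> > 0" if "t \<ge> t0" for t using t2 that t0 by simp
    show "(\<lambda>t. \<bar>gl t\<bar>) \<in> borel_measurable (lebesgue_on {t0..})"
      using gl_measurable[OF _ t0D, of "n - 1"] n by (intro borel_measurable_abs) auto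
    show "((\<lambda>t. \<bar>gl (x * t)\<bar> / \<bar>gl t\<bar>) \<longlongrightarrow> 1) at_top" if "x \<ge> 1" for x
      using tendsto_rabs[OF gl_slow[of x]] that by (simp add: abs_divide)
    show "w k \<in> borel_measurable (lebesgue_on {t0..})" for k
    proof (cases k)
      case 0
      have "F \<in> borel_measurable (lebesgue_on {a..})"
        by (intro measurable_on_half_line absolutely_integrable_imp_borel_measurable F) auto
      then have "F \<in> borel_measurable (lebesgue_on {t0..})"
        by (rule measurable_restrict_mono) (use t0 in auto)
      then show ?thesis by (simp add: 0 w_simps)
    next
      case (Suc i)
      have "(\<lambda>t. \<Sum>l<n. \<Sum>j<n. p $ l * (B ^\<^sub>m i) $$ (l, j) * g t $ j) \<in> borel_measurable (lebesgue_on {t0..})"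
        by (intro borel_measurable_sum borel_measurable_times borel_measurable_const gl_measurable[OF _ t0D]) auto
      moreover have "(\<Sum>l<n. \<Sum>j<n. p $ l * (B ^\<^sub>m i) $$ (l, j) * g t $ j) = w k t"
        if "t \<in> space (lebesgue_on {t0..})" for t
        using that scalar_prod_mult_mat_vec[OF p Bk gt] by (simp add: Suc w_simps s_def)
      ultimately show ?thesis by (rule measurable_cong[THEN iffD1, rotated])
    qed
    show "w k t = 0" if "t \<ge> t0" "k > Suc n" for k t
      using that s_zero by (cases k) (auto simp: w_simps)
    show "((\<lambda>t. (w k (x * t) - shift_exp (Suc n) (ln x) (\<lambda>l. w l t) k) / \<bar>gl t\<bar>) \<longlongrightarrow> 0) at_top"
      if "x \<ge> 1" for k x
      using w_lim[OF that] by (intro smalloD_tendsto) simp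
  qed
  define d where "d t = 1 / t * integral {a..t} F - (\<Sum>j\<le>Suc n. (-1) ^ j * w j t)" for t
  have "d \<in> o(\<lambda>t. \<bar>gl t\<bar>)"
    unfolding d_def using mean_asymp[OF a] F eventually_gl_nonzero
    by (intro smalloI_tendsto) (auto simp: w_simps)
  then have "(\<lambda>t. - d t) \<in> o(gl)" by simp
  moreover have "\<forall>\<^sub>F t in at_top. - d t =
      F t - 1 / t * (LINT y:{a..t}|lebesgue. F y) - resolvent_vec n B p \<bullet> g t"
    using eventually_D
  proof eventually_elim
    case (elim t)
    have "(\<Sum>j\<le>Suc n. (-1) ^ j * w j t) = F t - resolvent_vec n B p \<bullet> g t"
      unfolding sum.atMost_Suc_shift resolvent_vec_series[OF carrier_B p g_carrier[OF elim]]
      by (simp add: w_simps s_def sum_negf)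
    then show ?case using set_lebesgue_integral_eq[OF F] by (simp add: d_def)
  qed
  ultimately show ?thesis by (rule landau_o.small.in_cong[THEN iffD1, rotated])
qed

end

context rv_zero_diagonal
begin

text \<open>If an iterate is \<open>q g\<close> up to a small error, its increments are
  \<open>q (x^B - I) g\<close>, the form of the class Pi with index row \<open>q B\<close>. So
  \<open>mean_step\<close> applies again and yields \<open>q B (I + B)^(-1)\<close>.\<close>

lemma mean_diff_asymp:
  assumes a: "a > 0" and f: "locally_integrable_from a f" and Pi: "Pi_varying E n B g c f"
  shows "(\<lambda>t. mean_diff a f (Suc i) t - mean_index n B c i \<bullet> g t) \<in> o(gl)"
proof (induction i)
  case 0
  have c: "c \<in> carrier_vec n" using Pi by (simp add: Pi_varying_def)
  have "(\<lambda>t. f (x * t) - f t - (\<Sum>k\<le>n. ln x ^ Suc k / fact (Suc k) * (c \<bullet> (B ^\<^sub>m k *\<^sub>v g t)))) \<in> o(gl)"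
    if x: "x \<ge> 1" for x
  proof -
    have "\<forall>\<^sub>F t in at_top. f (x * t) - f t - Pi_coeff n B c x \<bullet> g t =
        f (x * t) - f t - (\<Sum>k\<le>n. ln x ^ Suc k / fact (Suc k) * (c \<bullet> (B ^\<^sub>m k *\<^sub>v g t)))"
      using eventually_D by eventually_elim (subst Pi_coeff_scalar_prod[OF B c g_carrier], use x in auto)
    moreover have "(\<lambda>t. f (x * t) - f t - Pi_coeff n B c x \<bullet> g t) \<in> o(gl)"
      using Pi x by (auto simp: Pi_varying_def)
    ultimately show ?thesis by (rule landau_o.small.in_cong[THEN iffD1])
  qed
  from mean_step[OF a mean_diff_absolutely_integrable[where i = 0, OF a f] c] this show ?case
    by simp
next
  case (Suc i)
  let ?q = "mean_index n B c i"
  define p where "p = transpose_mat B *\<^sub>v ?q"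
  have q: "?q \<in> carrier_vec n" by simp
  have p: "p \<in> carrier_vec n"
    unfolding p_def using carrier_B by (intro mult_mat_vec_carrier[of _ n n]) auto
  have Bk: "B ^\<^sub>m k \<in> carrier_mat n n" for k by (rule pow_carrier_mat[OF carrier_B])
  have pB: "p \<bullet> (B ^\<^sub>m k *\<^sub>v v) = ?q \<bullet> (B ^\<^sub>m Suc k *\<^sub>v v)" if v: "v \<in> carrier_vec n" for k v
  proof -
    have "B ^\<^sub>m Suc k = B * B ^\<^sub>m k"
      using pow_mat_add[OF carrier_B, of 1 k] carrier_B by simp
    then show ?thesis
      unfolding p_def transpose_vec_mult_scalar[OF carrier_B mult_mat_vec_carrier[OF Bk v] q]
      by (simp only: assoc_mult_mat_vec[OF carrier_B Bk v])
  qed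
  let ?F = "mean_diff a f (Suc i)"
  have "(\<lambda>t. ?F (x * t) - ?F t - (\<Sum>k\<le>n. ln x ^ Suc k / fact (Suc k) * (p \<bullet> (B ^\<^sub>m k *\<^sub>v g t)))) \<in> o(gl)"
    if x: "x \<ge> 1" for x
  proof -
    let ?S = "\<lambda>t. \<Sum>k\<le>n. ln x ^ k / fact k * (?q \<bullet> (B ^\<^sub>m k *\<^sub>v g t))"
    have "\<forall>\<^sub>F t in at_top. (?F (x * t) - ?q \<bullet> g (x * t)) - (?F t - ?q \<bullet> g t) + (?q \<bullet> g (x * t) - ?S t) =
        ?F (x * t) - ?F t - (\<Sum>k\<le>n. ln x ^ Suc k / fact (Suc k) * (p \<bullet> (B ^\<^sub>m k *\<^sub>v g t)))"
      using eventually_D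
    proof eventually_elim
      case (elim t)
      note gt = g_carrier[OF elim]
      \<comment> \<open>The added term vanishes; it leaves \<open>n + 1\<close> terms after index 0
        is split off.\<close>
      have "?S t = (\<Sum>k\<le>Suc n. ln x ^ k / fact k * (?q \<bullet> (B ^\<^sub>m k *\<^sub>v g t)))"
        using strictly_upper_pow_large[OF B _ q gt, of "Suc n"] by (simp del: pow_mat.simps)
      also have "\<dots> = ?q \<bullet> g t + (\<Sum>k\<le>n. ln x ^ Suc k / fact (Suc k) * (p \<bullet> (B ^\<^sub>m k *\<^sub>v g t)))"
        unfolding sum.atMost_Suc_shift pB[OF gt]
        using carrier_B gt by (simp add: one_mult_mat_vec del: fact_Suc power_Suc pow_mat.simps(2))
      finally show ?case by simp
    qed
    moreover have "(\<lambda>t. (?F (x * t) - ?q \<bullet> g (x * t)) - (?F t - ?q \<bullet> g t) + (?q \<bullet> g (x * t) - ?S t)) \<in> o(gl)"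
      using x by (intro sum_in_smallo small_dilate[OF Suc.IH] Suc.IH g_dilate) auto
    ultimately show ?thesis by (rule landau_o.small.in_cong[THEN iffD1])
  qed
  from mean_step[OF a mean_diff_absolutely_integrable[where i = "Suc i", OF a f] p this] show ?case
    by (simp add: p_def)
qed

lemma g_nonzero:
  assumes "i < n"
  shows "\<forall>\<^sub>F t in at_top. g t $ i \<noteq> 0"
proof -
  have "eventually_constant_sign (\<lambda>t. g t $ i)"
    using rv assms by (auto simp: regularly_varying_def rate_vector_def)
  then show ?thesis unfolding eventually_constant_sign_def
    by (auto elim: eventually_mono)
qed

lemma g_order:
  assumes "i < j" "j < n"
  shows "(\<lambda>t. g t $ j) \<in> o(\<lambda>t. g t $ i)"
  using assms
proof (induction j rule: less_induct)
  case (less j)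
  then obtain k where k: "j = Suc k" by (cases j) auto
  have "(\<lambda>t. g t $ j) \<in> o(\<lambda>t. g t $ k)"
    using rv less.prems k by (auto simp: regularly_varying_def rate_vector_def)
  then show ?case using less k by (cases "i = k") (auto intro: landau_o.small_trans)
qed

lemma gl_bigo:
  assumes "i < n"
  shows "gl \<in> O(\<lambda>t. g t $ i)"
proof (cases "i = n - 1")
  case False
  then have "gl \<in> o(\<lambda>t. g t $ i)" using assms by (intro g_order) auto
  then show ?thesis by (rule landau_o.small_imp_big)
qed simp

section \<open>Transfer of the expansions from \<open>g\<close> to the vector of iterated
  means\<close>

context
  fixes a :: real and f :: "real \<Rightarrow> real" and E :: "real set" and c :: "real vec"
  assumes a: "a > 0" and f: "locally_integrable_from a f" and Pi: "Pi_varying E n B g c f"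
begin

abbreviation C :: "real \<Rightarrow> real vec" where "C \<equiv> mean_diff_vec n a f"
abbreviation Q :: "real mat" where "Q \<equiv> mean_mat n B c"

lemma c_carrier: "c \<in> carrier_vec n"
  using Pi by (simp add: Pi_varying_def)

lemma C_carrier: "C t \<in> carrier_vec n"
  by (simp add: mean_diff_vec_def)

lemma C_error: "i < n \<Longrightarrow> (\<lambda>t. (C t - Q *\<^sub>v g t) $ i) \<in> o(gl)"
proof -
  assume i: "i < n"
  have "(C t - Q *\<^sub>v g t) $ i = mean_diff a f (Suc i) t - mean_index n B c i \<bullet> g t" for t
  proof -
    have "i < dim_vec (Q *\<^sub>v g t)" using i by (simp add: mean_mat_def)
    from index_minus_vec(1)[OF this] show ?thesis
      using i by (simp only: mean_mat_mult_vec mean_diff_vec_def index_vec)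
  qed
  then show ?thesis using mean_diff_asymp[OF a f Pi, of i] by simp
qed

lemma scalar_prod_C:
  assumes p: "p \<in> carrier_vec n"
  shows "(\<lambda>t. p \<bullet> C t - p \<bullet> (Q *\<^sub>v g t)) \<in> o(gl)"
proof -
  have Qg: "Q *\<^sub>v g t \<in> carrier_vec n" if "t \<in> D" for t
    by (rule mult_mat_vec_carrier[OF mean_mat_carrier g_carrier[OF that]])
  have "(\<lambda>t. p \<bullet> (C t - Q *\<^sub>v g t)) \<in> o(gl)"
    by (rule scalar_prod_small[OF p C_error])
      (use eventually_D Qg C_carrier in \<open>auto elim!: eventually_mono\<close>)
  moreover have "\<forall>\<^sub>F t in at_top. p \<bullet> (C t - Q *\<^sub>v g t) = p \<bullet> C t - p \<bullet> (Q *\<^sub>v g t)"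
    using eventually_D by eventually_elim (rule scalar_prod_minus_distrib[OF p C_carrier Qg])
  ultimately show ?thesis by (simp add: landau_o.small.in_cong)
qed

lemma scalar_prod_K_pow:
  assumes "p \<in> carrier_vec n" "t \<in> D"
  shows "p \<bullet> (K_mat n ^\<^sub>m k *\<^sub>v (Q *\<^sub>v g t)) = p \<bullet> (Q *\<^sub>v (B ^\<^sub>m k *\<^sub>v g t))"
  by (simp only: K_mat_pow_mean_mat[OF n B c_carrier g_carrier[OF assms(2)]])

text \<open>Entries of \<open>Q\<close> left of the diagonal vanish, and the components of
  \<open>g\<close> belonging to entries right of it are of smaller order.\<close>

lemma C_asymp:
  assumes i: "i < n"
  shows "((\<lambda>t. C t $ i / g t $ i) \<longlongrightarrow> Q $$ (i, i)) at_top"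
proof -
  let ?q = "mean_index n B c i"
  have "(\<lambda>t. (C t - Q *\<^sub>v g t) $ i + (\<Sum>j\<in>{..<n} - {i}. ?q $ j * g t $ j)) \<in> o(\<lambda>t. g t $ i)"
  proof (intro sum_in_smallo big_sum_in_smallo landau_o.small_big_trans[OF C_error[OF i] gl_bigo[OF i]])
    fix j assume "j \<in> {..<n} - {i}"
    then consider "j < i" | "i < j" "j < n" by fastforce
    then show "(\<lambda>t. ?q $ j * g t $ j) \<in> o(\<lambda>t. g t $ i)"
    proof cases
      case 1
      then show ?thesis using mean_index_coord[OF n B c_carrier i] by simp
    next
      case 2
      then show ?thesis by (cases "?q $ j = 0") (auto intro: g_order)
    qed
  qed
  moreover have "\<forall>\<^sub>F t in at_top. (C t - Q *\<^sub>v g t) $ i + (\<Sum>j\<in>{..<n} - {i}. ?q $ j * g t $ j) =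
      C t $ i - Q $$ (i, i) * g t $ i"
    using eventually_D
  proof eventually_elim
    case (elim t)
    have "?q \<bullet> g t = (\<Sum>j<n. ?q $ j * g t $ j)"
      using g_carrier[OF elim] by (simp add: scalar_prod_def atLeast0LessThan)
    also have "\<dots> = ?q $ i * g t $ i + (\<Sum>j\<in>{..<n} - {i}. ?q $ j * g t $ j)"
      using i by (intro sum.remove) auto
    finally have "?q \<bullet> g t = Q $$ (i, i) * g t $ i + (\<Sum>j\<in>{..<n} - {i}. ?q $ j * g t $ j)"
      using i by (simp add: mean_mat_def)
    moreover have "i < dim_vec (Q *\<^sub>v g t)" using i by (simp add: mean_mat_def)
    then have "(C t - Q *\<^sub>v g t) $ i = C t $ i - ?q \<bullet> g t"
      by (simp only: index_minus_vec(1) mean_mat_mult_vec[OF i])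
    ultimately show ?case by simp
  qed
  ultimately have "(\<lambda>t. C t $ i - Q $$ (i, i) * g t $ i) \<in> o(\<lambda>t. g t $ i)"
    by (simp add: landau_o.small.in_cong)
  from tendsto_add[OF smalloD_tendsto[OF this] tendsto_const[of "Q $$ (i, i)"]]
  have "((\<lambda>t. (C t $ i - Q $$ (i, i) * g t $ i) / g t $ i + Q $$ (i, i)) \<longlongrightarrow> Q $$ (i, i)) at_top"
    by simp
  moreover have "\<forall>\<^sub>F t in at_top. (C t $ i - Q $$ (i, i) * g t $ i) / g t $ i + Q $$ (i, i) = C t $ i / g t $ i"
    using g_nonzero[OF i] by eventually_elim (simp add: field_simps)
  ultimately show ?thesis by (rule Lim_transform_eventually)
qed

context
  assumes diag: "\<And>i. i < n \<Longrightarrow> Q $$ (i, i) \<noteq> 0"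
begin

lemma C_sign:
  assumes i: "i < n"
  shows "eventually_constant_sign (\<lambda>t. C t $ i)"
proof -
  have "eventually_constant_sign (\<lambda>t. g t $ i)"
    using rv i by (auto simp: regularly_varying_def rate_vector_def)
  moreover have "(\<forall>\<^sub>F t in at_top. C t $ i / g t $ i > 0) \<or> (\<forall>\<^sub>F t in at_top. C t $ i / g t $ i < 0)"
    using order_tendstoD[OF C_asymp[OF i], of 0] diag[OF i] by linarith
  ultimately consider
      "\<forall>\<^sub>F t in at_top. g t $ i > 0" "\<forall>\<^sub>F t in at_top. C t $ i / g t $ i > 0"
    | "\<forall>\<^sub>F t in at_top. g t $ i > 0" "\<forall>\<^sub>F t in at_top. C t $ i / g t $ i < 0"
    | "\<forall>\<^sub>F t in at_top. g t $ i < 0" "\<forall>\<^sub>F t in at_top. C t $ i / g t $ i > 0"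
    | "\<forall>\<^sub>F t in at_top. g t $ i < 0" "\<forall>\<^sub>F t in at_top. C t $ i / g t $ i < 0"
    unfolding eventually_constant_sign_def by blast
  then have "(\<forall>\<^sub>F t in at_top. C t $ i > 0) \<or> (\<forall>\<^sub>F t in at_top. C t $ i < 0)"
  proof cases
    case 1
    then have "\<forall>\<^sub>F t in at_top. C t $ i > 0"
      by eventually_elim (auto simp: zero_less_divide_iff)
    then show ?thesis ..
  next
    case 2
    then have "\<forall>\<^sub>F t in at_top. C t $ i < 0"
      by eventually_elim (auto simp: divide_less_0_iff)
    then show ?thesis ..
  next
    case 3
    then have "\<forall>\<^sub>F t in at_top. C t $ i < 0"
      by eventually_elim (auto simp: zero_less_divide_iff)
    then show ?thesis ..
  next
    case 4
    then have "\<forall>\<^sub>F t in at_top. C t $ i > 0"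
      by eventually_elim (auto simp: divide_less_0_iff)
    then show ?thesis ..
  qed
  then show ?thesis unfolding eventually_constant_sign_def .
qed

lemma C_nonzero: "i < n \<Longrightarrow> \<forall>\<^sub>F t in at_top. C t $ i \<noteq> 0"
  using C_sign[of i] unfolding eventually_constant_sign_def by (auto elim: eventually_mono)

text \<open>The limit of \<open>C t $ i / g t $ i\<close> is nonzero and can be inverted; for the
  last index this turns errors relative to \<open>gl\<close> into errors relative to
  \<open>C\<close>.\<close>

lemma g_bigo_C:
  assumes i: "i < n"
  shows "(\<lambda>t. g t $ i) \<in> O(\<lambda>t. C t $ i)"
proof (rule bigoI_tendsto[OF _ C_nonzero[OF i]])
  show "((\<lambda>t. g t $ i / C t $ i) \<longlongrightarrow> inverse (Q $$ (i, i))) at_top"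
    using tendsto_inverse[OF C_asymp[OF i] diag[OF i]] by (simp add: field_simps)
qed

lemma C_rate_vector: "rate_vector {a..} n C"
  unfolding rate_vector_def
proof (intro conjI allI impI)
  fix i assume i: "Suc i < n"
  have "(\<lambda>t. C t $ Suc i) \<in> O(\<lambda>t. g t $ Suc i)"
    by (rule bigoI_tendsto[OF C_asymp g_nonzero]) (use i in auto)
  also have "(\<lambda>t. g t $ Suc i) \<in> o(\<lambda>t. g t $ i)" using i by (intro g_order) auto
  also have "(\<lambda>t. g t $ i) \<in> O(\<lambda>t. C t $ i)" using i by (intro g_bigo_C) auto
  finally show "(\<lambda>t. C t $ Suc i) \<in> o(\<lambda>t. C t $ i)" .
qed (use C_sign C_carrier in \<open>auto simp: nbhd_infinity_def\<close>)

lemma small_C: "u \<in> o(gl) \<Longrightarrow> u \<in> o(\<lambda>t. C t $ (n - 1))"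
  using n by (intro landau_o.small_big_trans[OF _ g_bigo_C]) auto

text \<open>Up to small errors \<open>C(xt)\<close> is \<open>Q g(xt)\<close>, then
  \<open>Q x^B g(t)\<close>, which equals \<open>x^K Q g(t)\<close> by the intertwining relation,
  and finally \<open>x^K C(t)\<close>.\<close>

lemma C_regularly_varying: "regularly_varying {a..} n (K_mat n) C"
  unfolding regularly_varying_def
proof (intro conjI allI impI index_matrix_K_mat C_rate_vector)
  fix i assume i: "i < n"
  then have "(\<lambda>t. C t $ i) = mean_diff a f (Suc i)"
    by (simp add: mean_diff_vec_def fun_eq_iff del: mean_diff.simps)
  then show "(\<lambda>t. C t $ i) \<in> borel_measurable (lebesgue_on {a..})"
    using mean_diff_measurable[OF a f, of "Suc i"] by (simp only:)
next
  fix x :: real assume x: "x > 0"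
  have K: "mat_powr x (K_mat n) \<in> carrier_mat n n"
    by (intro mat_powr_carrier strictly_upper_carrier strictly_upper_K_mat)
  show "vec_smallo_last n (\<lambda>t. C (x * t) - mat_powr x (K_mat n) *\<^sub>v C t) C"
    unfolding vec_smallo_last_def
  proof (intro allI impI small_C)
    fix i assume i: "i < n"
    let ?e = "unit_vec n i :: real vec" and ?q = "mean_index n B c i"
    \<comment> \<open>This is row \<open>i\<close> of \<open>x^K\<close>; pairing with it carries
      the error of \<open>C\<close> at \<open>t\<close> through the matrix power.\<close>
    define p where "p = transpose_mat (mat_powr x (K_mat n)) *\<^sub>v ?e"
    have p: "p \<in> carrier_vec n" unfolding p_def using K by (intro mult_mat_vec_carrier[of _ n n]) auto
    have pv: "p \<bullet> v = (mat_powr x (K_mat n) *\<^sub>v v) $ i" if "v \<in> carrier_vec n" for v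
      unfolding p_def using transpose_vec_mult_scalar[OF K that, of ?e] i mult_mat_vec_carrier[OF K that]
      by (simp add: scalar_prod_left_unit[OF _ i])
    have e: "(\<lambda>t. C t $ i - ?q \<bullet> g t) \<in> o(gl)"
      using mean_diff_asymp[OF a f Pi, of i] i by (simp add: mean_diff_vec_def del: mean_diff.simps)
    \<comment> \<open>Three errors: the expansion of \<open>C\<close> at \<open>x * t\<close>, the
      law for \<open>g\<close>, and the expansion of \<open>C\<close> at \<open>t\<close> seen
      through \<open>p\<close>.\<close>
    have "(\<lambda>t. (C (x * t) $ i - ?q \<bullet> g (x * t)) +
        (?q \<bullet> g (x * t) - (\<Sum>k\<le>n. ln x ^ k / fact k * (?q \<bullet> (B ^\<^sub>m k *\<^sub>v g t)))) -
        (p \<bullet> C t - p \<bullet> (Q *\<^sub>v g t))) \<in> o(gl)"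
      by (intro sum_in_smallo small_dilate[OF e x] g_dilate[OF _ x] scalar_prod_C p) simp
    moreover have "\<forall>\<^sub>F t in at_top. (C (x * t) $ i - ?q \<bullet> g (x * t)) +
        (?q \<bullet> g (x * t) - (\<Sum>k\<le>n. ln x ^ k / fact k * (?q \<bullet> (B ^\<^sub>m k *\<^sub>v g t)))) -
        (p \<bullet> C t - p \<bullet> (Q *\<^sub>v g t)) = (C (x * t) - mat_powr x (K_mat n) *\<^sub>v C t) $ i"
      using eventually_D
    proof eventually_elim
      case (elim t)
      have Qg: "Q *\<^sub>v g t \<in> carrier_vec n"
        by (rule mult_mat_vec_carrier[OF mean_mat_carrier g_carrier[OF elim]])
      have "?e \<bullet> (Q *\<^sub>v (B ^\<^sub>m k *\<^sub>v g t)) = ?q \<bullet> (B ^\<^sub>m k *\<^sub>v g t)" for k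
      proof -
        have "B ^\<^sub>m k *\<^sub>v g t \<in> carrier_vec n"
          by (rule mult_mat_vec_carrier[OF pow_carrier_mat[OF carrier_B] g_carrier[OF elim]])
        from mult_mat_vec_carrier[OF mean_mat_carrier this] show ?thesis
          by (simp add: scalar_prod_left_unit[OF _ i] mean_mat_mult_vec[OF i])
      qed
      then have "p \<bullet> (Q *\<^sub>v g t) = (\<Sum>k\<le>n. ln x ^ k / fact k * (?q \<bullet> (B ^\<^sub>m k *\<^sub>v g t)))"
        using scalar_prod_mat_powr[OF strictly_upper_K_mat, of ?e n "Q *\<^sub>v g t" x] Qg
          transpose_vec_mult_scalar[OF K Qg, of ?e]
        by (simp add: p_def scalar_prod_K_pow[OF _ elim])
      then show ?case using pv[OF C_carrier[of t]] i K by simp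
    qed
    ultimately show "(\<lambda>t. (C (x * t) - mat_powr x (K_mat n) *\<^sub>v C t) $ i) \<in> o(gl)"
      by (simp add: landau_o.small.in_cong)
  qed
qed

text \<open>From \<open>(1, ..., 1) K^k Q = (1, ..., 1) Q B^k = c B^k\<close>, the coefficient for
  \<open>K_mat n\<close> composed with \<open>Q\<close> is the coefficient for \<open>B\<close> and
  \<open>c\<close>.\<close>

lemma C_Pi_varying: "Pi_varying E n (K_mat n) C (vec n (\<lambda>_. 1)) f"
  unfolding Pi_varying_def
proof (intro conjI allI impI small_C)
  fix x :: real assume x: "x > 0"
  let ?one = "vec n (\<lambda>_. 1) :: real vec"
  let ?p = "Pi_coeff n (K_mat n) ?one x"
  have "(\<lambda>t. (f (x * t) - f t - Pi_coeff n B c x \<bullet> g t) - (?p \<bullet> C t - ?p \<bullet> (Q *\<^sub>v g t))) \<in> o(gl)"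
    using Pi x by (intro sum_in_smallo(2)[OF _ scalar_prod_C[OF Pi_coeff_carrier]])
      (auto simp: Pi_varying_def)
  moreover have "\<forall>\<^sub>F t in at_top. (f (x * t) - f t - Pi_coeff n B c x \<bullet> g t) -
      (?p \<bullet> C t - ?p \<bullet> (Q *\<^sub>v g t)) = f (x * t) - f t - ?p \<bullet> C t"
    using eventually_D
  proof eventually_elim
    case (elim t)
    have Qg: "Q *\<^sub>v g t \<in> carrier_vec n"
      by (rule mult_mat_vec_carrier[OF mean_mat_carrier g_carrier[OF elim]])
    have "?one \<bullet> (Q *\<^sub>v (B ^\<^sub>m k *\<^sub>v g t)) = c \<bullet> (B ^\<^sub>m k *\<^sub>v g t)" for k
    proof -
      have Bg: "B ^\<^sub>m k *\<^sub>v g t \<in> carrier_vec n"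
        by (rule mult_mat_vec_carrier[OF pow_carrier_mat[OF carrier_B] g_carrier[OF elim]])
      have "?one \<bullet> (Q *\<^sub>v (B ^\<^sub>m k *\<^sub>v g t)) = (\<Sum>j<n. mean_index n B c j \<bullet> (B ^\<^sub>m k *\<^sub>v g t))"
        using carrier_vecD[OF mult_mat_vec_carrier[OF mean_mat_carrier Bg]]
        by (simp add: scalar_prod_def[of ?one] row_mean_mat atLeast0LessThan)
      then show ?thesis using mean_index_sum[OF n B c_carrier Bg] by simp
    qed
    then have "?p \<bullet> (Q *\<^sub>v g t) = Pi_coeff n B c x \<bullet> g t"
      using Pi_coeff_scalar_prod[OF strictly_upper_K_mat _ Qg x, of ?one]
        Pi_coeff_scalar_prod[OF B c_carrier g_carrier[OF elim] x]
      by (simp add: scalar_prod_K_pow[OF _ elim] del: fact_Suc power_Suc)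
    then show ?case by simp
  qed
  ultimately show "(\<lambda>t. f (x * t) - f t - ?p \<bullet> C t) \<in> o(gl)"
    by (simp add: landau_o.small.in_cong)
qed (use Pi in \<open>auto simp: Pi_varying_def\<close>)

end

end

end

lemma strictly_upper_if_zero_diagonal:
  assumes "index_matrix n B" "zero_diagonal n B"
  shows "strictly_upper n B"
  unfolding strictly_upper_def
proof (intro conjI allI impI)
  show B: "B \<in> carrier_mat n n" using assms(1) by (simp add: index_matrix_def)
  fix i j assume "i < n" "j \<le> i"
  then show "B $$ (i, j) = 0"
    using assms B by (cases "j = i") (auto simp: index_matrix_def zero_diagonal_def upper_triangular_def)
qed

theorem theorem5p3:
  fixes n :: nat and B :: "real mat" and D E :: "real set"
    and g :: "real \<Rightarrow> real vec" and f :: "real \<Rightarrow> real" and a :: real and c :: "real vec"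
  assumes "n \<ge> 1"
    and "index_matrix n B"
    and "zero_diagonal n B"
    and "regularly_varying D n B g"
    and "a > 0"
    and "{a..} \<subseteq> E"
    and "locally_integrable_from a f"
    and "Pi_varying E n B g c f"
  shows "\<exists>Q. Q \<in> carrier_mat n n \<and> upper_triangular Q \<and>
      vec_smallo_last n (\<lambda>t. mean_diff_vec n a f t - Q *\<^sub>v g t) g \<and>
      (invertible_mat Q \<longleftrightarrow> c $ 0 * (\<Prod>i<n - 1. B $$ (i, Suc i)) \<noteq> 0) \<and>
      (invertible_mat Q \<longrightarrow>
        rate_vector {a..} n (mean_diff_vec n a f) \<and>
        regularly_varying {a..} n (K_mat n) (mean_diff_vec n a f) \<and>
        Pi_varying E n (K_mat n) (mean_diff_vec n a f) (vec n (\<lambda>_. 1)) f)"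
proof -
  have B: "strictly_upper n B"
    by (rule strictly_upper_if_zero_diagonal) (fact assms)+
  interpret rv_zero_diagonal n B D g
    by unfold_locales (fact assms B)+
  have c: "c \<in> carrier_vec n" using assms(8) by (simp add: Pi_varying_def)
  let ?Q = "mean_mat n B c"
  have inv: "invertible_mat ?Q \<longleftrightarrow> c $ 0 * (\<Prod>i<n - 1. B $$ (i, Suc i)) \<noteq> 0"
    by (rule invertible_mean_mat[OF assms(1) B c])
  \<comment> \<open>Every diagonal entry is a partial product of the nonzero product in
    \<open>inv\<close>.\<close>
  have "?Q $$ (i, i) \<noteq> 0" if "invertible_mat ?Q" "i < n" for i
    using that(1) unfolding inv mean_mat_diag[OF assms(1) B c that(2)]
    using that(2) by auto
  then have "invertible_mat ?Q \<longrightarrow> rate_vector {a..} n (mean_diff_vec n a f) \<and>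
      regularly_varying {a..} n (K_mat n) (mean_diff_vec n a f) \<and>
      Pi_varying E n (K_mat n) (mean_diff_vec n a f) (vec n (\<lambda>_. 1)) f"
    using C_rate_vector[OF assms(5,7,8)] C_regularly_varying[OF assms(5,7,8)]
      C_Pi_varying[OF assms(5,7,8)] by blast
  moreover have "vec_smallo_last n (\<lambda>t. mean_diff_vec n a f t - ?Q *\<^sub>v g t) g"
    unfolding vec_smallo_last_def using C_error[OF assms(5,7,8)] by blast
  ultimately show ?thesis
    using mean_mat_carrier mean_mat_upper_triangular[OF assms(1) B c] inv by blast
qed

end
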